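(* For an extension $\vdash$ of rational Gödel logic $\mathbf{RG}$ the following are equivalent: (i) $\vdash$ is passively structurally complete; (ii) $\vdash$ is algebraized by a quasivariety with the joint embedding property; (iii) $\vdash$ is algebraized by a quasivariety whose nontrivial members have isomorphic zero-generated subalgebras.
   Context: A BL-algebra is an algebra $\langle A;\wedge,\vee,\cdot,\to,0,1\rangle$ such that $\langle A;\wedge,\vee,0,1\rangle$ is a bounded lattice, $\langle A;\cdot,1\rangle$ is a commutative monoid, $a\cdot b\le c\iff a\le b\to c$, $(a\to c)\vee(c\to a)=1$ and $a\wedge c=a\cdot(a\to c)$. The standard Gödel algebra $[0,1]_G$ is the BL-algebra on the real $[0,1]$ with usual order, $a\cdot c=\min\{a,c\}$ and $a\to c=1$ if $a\le c$, $c$ otherwise; Gödel algebras are the members of the variety it generates. With new constants $\{\mathbf{c}_q:q\in[0,1]\cap\mathbb{Q}\}$, a rational Gödel algebra is an algebra in the BL language expanded by these constants whose BL-reduct is a Gödel algebra and satisfying $\mathbf{c}_p\cdot\mathbf{c}_q\approx\mathbf{c}_{p\cdot q}$, $\mathbf{c}_p\to\mathbf{c}_q\approx\mathbf{c}_{p\to q}$ (computed in $[0,1]_G$), $\mathbf{c}_0\approx0$, $\mathbf{c}_1\approx1$; $\mathsf{RGA}$ is their variety. Rational Gödel logic $\mathbf{RG}$: $\Gamma\vdash\varphi$ iff for some finite $\Delta\subseteq\Gamma$, $\{\delta\approx1:\delta\in\Delta\}\models_{\mathsf{RGA}}\varphi\approx1$. Logics are finitary substitution-invariant consequence relations; an extension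 is such a relation on the same formulas containing the given one. Each extension $\vdash$ of $\mathbf{RG}$ is algebraized (via $x\approx1$ and $(x\to y)\wedge(y\to x)$) by a unique subquasivariety of $\mathsf{RGA}$: the class of $\mathbf{A}\in\mathsf{RGA}$ such that whenever $\gamma_1,\dots,\gamma_n\vdash\varphi$, every assignment sending all $\gamma_i$ to $1$ sends $\varphi$ to $1$. A rule $\Gamma\rhd\varphi$ (finite $\Gamma$) is derivable in $\vdash$ if $\Gamma\vdash\varphi$; it is passive if there is no substitution $\sigma$ making every $\sigma(\gamma)$, $\gamma\in\Gamma$, a theorem of $\vdash$. $\vdash$ is passively structurally complete if every passive rule is derivable. A quasivariety has the joint embedding property if any two nontrivial members embed into a common member. *)

theory Defs
  imports Complex_Main "HOL-Library.Countable_Set" "HOL-Algebra.Group"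
begin

section \<open>BL-algebras and Goedel algebras\<close>

record 'a bl = "'a monoid" +
  bmeet :: "'a \<Rightarrow> 'a \<Rightarrow> 'a" (infixl "\<curlywedge>\<index>" 70)
  bjoin :: "'a \<Rightarrow> 'a \<Rightarrow> 'a" (infixl "\<curlyvee>\<index>" 65)
  bimp :: "'a \<Rightarrow> 'a \<Rightarrow> 'a" (infixr "\<leadsto>\<index>" 60)
  bzero :: 'a ("\<zero>\<index>")

abbreviation bl_le :: "('a, 'm) bl_scheme \<Rightarrow> 'a \<Rightarrow> 'a \<Rightarrow> bool" where
  "bl_le A a b \<equiv> bmeet A a b = a"

locale bl_algebra = comm_monoid A for A :: "('a, 'm) bl_scheme" (structure) +
  assumes meet_closed: "\<lbrakk>a \<in> carrier A; b \<in> carrier A\<rbrakk> \<Longrightarrow> a \<curlywedge> b \<in> carrier A"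
    and join_closed: "\<lbrakk>a \<in> carrier A; b \<in> carrier A\<rbrakk> \<Longrightarrow> a \<curlyvee> b \<in> carrier A"
    and imp_closed: "\<lbrakk>a \<in> carrier A; b \<in> carrier A\<rbrakk> \<Longrightarrow> a \<leadsto> b \<in> carrier A"
    and zero_closed: "\<zero> \<in> carrier A"
    and meet_comm: "\<lbrakk>a \<in> carrier A; b \<in> carrier A\<rbrakk> \<Longrightarrow> a \<curlywedge> b = b \<curlywedge> a"
    and join_comm: "\<lbrakk>a \<in> carrier A; b \<in> carrier A\<rbrakk> \<Longrightarrow> a \<curlyvee> b = b \<curlyvee> a"
    and meet_assoc: "\<lbrakk>a \<in> carrier A; b \<in> carrier A; c \<in> carrier A\<rbrakk>
      \<Longrightarrow> (a \<curlywedge> b) \<curlywedge> c = a \<curlywedge> (b \<curlywedge> c)"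
    and join_assoc: "\<lbrakk>a \<in> carrier A; b \<in> carrier A; c \<in> carrier A\<rbrakk>
      \<Longrightarrow> (a \<curlyvee> b) \<curlyvee> c = a \<curlyvee> (b \<curlyvee> c)"
    and meet_absorb: "\<lbrakk>a \<in> carrier A; b \<in> carrier A\<rbrakk> \<Longrightarrow> a \<curlywedge> (a \<curlyvee> b) = a"
    and join_absorb: "\<lbrakk>a \<in> carrier A; b \<in> carrier A\<rbrakk> \<Longrightarrow> a \<curlyvee> (a \<curlywedge> b) = a"
    and zero_least: "a \<in> carrier A \<Longrightarrow> bl_le A \<zero> a"
    and one_greatest: "a \<in> carrier A \<Longrightarrow> bl_le A a \<one>"
    and residuation: "\<lbrakk>a \<in> carrier A; b \<in> carrier A; c \<in> carrier A\<rbrakk>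
      \<Longrightarrow> bl_le A (a \<otimes> b) c \<longleftrightarrow> bl_le A a (b \<leadsto> c)"
    and prelinearity: "\<lbrakk>a \<in> carrier A; c \<in> carrier A\<rbrakk> \<Longrightarrow> (a \<leadsto> c) \<curlyvee> (c \<leadsto> a) = \<one>"
    and divisibility: "\<lbrakk>a \<in> carrier A; c \<in> carrier A\<rbrakk> \<Longrightarrow> a \<curlywedge> c = a \<otimes> (a \<leadsto> c)"

datatype bl_term =
    BVar nat | BZero | BOne
  | BMeet bl_term bl_term | BJoin bl_term bl_term
  | BMult bl_term bl_term | BImp bl_term bl_term

primrec bl_eval :: "('a, 'm) bl_scheme \<Rightarrow> (nat \<Rightarrow> 'a) \<Rightarrow> bl_term \<Rightarrow> 'a" where
  "bl_eval A v (BVar n) = v n"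
| "bl_eval A v BZero = \<zero>\<^bsub>A\<^esub>"
| "bl_eval A v BOne = \<one>\<^bsub>A\<^esub>"
| "bl_eval A v (BMeet s t) = bl_eval A v s \<curlywedge>\<^bsub>A\<^esub> bl_eval A v t"
| "bl_eval A v (BJoin s t) = bl_eval A v s \<curlyvee>\<^bsub>A\<^esub> bl_eval A v t"
| "bl_eval A v (BMult s t) = bl_eval A v s \<otimes>\<^bsub>A\<^esub> bl_eval A v t"
| "bl_eval A v (BImp s t) = bl_eval A v s \<leadsto>\<^bsub>A\<^esub> bl_eval A v t"

definition bl_identity :: "('a, 'm) bl_scheme \<Rightarrow> bl_term \<Rightarrow> bl_term \<Rightarrow> bool" where
  "bl_identity A s t \<longleftrightarrow> (\<forall>v. range v \<subseteq> carrier A \<longrightarrow> bl_eval A v s = bl_eval A v t)"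

definition standard_goedel :: "real bl" where
  "standard_goedel = \<lparr>carrier = {0..1}, monoid.mult = min, one = 1, bmeet = min, bjoin = max,
     bimp = (\<lambda>a c. if a \<le> c then 1 else c), bzero = 0\<rparr>"

text \<open>The variety generated by an algebra is the class of all models of its identities.\<close>

definition goedel_algebra :: "('a, 'm) bl_scheme \<Rightarrow> bool" where
  "goedel_algebra A \<longleftrightarrow> bl_algebra A \<and>
     (\<forall>s t. bl_identity standard_goedel s t \<longrightarrow> bl_identity A s t)"

section \<open>Rational Goedel algebras\<close>

typedef unit_rat = "{q :: rat. 0 \<le> q \<and> q \<le> 1}"
  by (rule exI[of _ 0]) simp

definition real_of_unit_rat :: "unit_rat \<Rightarrow> real" where
  "real_of_unit_rat q = of_rat (Rep_unit_rat q)"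

record 'a ralg = "'a bl" +
  cst :: "unit_rat \<Rightarrow> 'a"

definition ralg_closed :: "'a ralg \<Rightarrow> bool" where
  "ralg_closed A \<longleftrightarrow>
     (\<forall>a\<in>carrier A. \<forall>b\<in>carrier A.
        a \<otimes>\<^bsub>A\<^esub> b \<in> carrier A \<and> a \<curlywedge>\<^bsub>A\<^esub> b \<in> carrier A \<and>
        a \<curlyvee>\<^bsub>A\<^esub> b \<in> carrier A \<and> a \<leadsto>\<^bsub>A\<^esub> b \<in> carrier A) \<and>
     \<zero>\<^bsub>A\<^esub> \<in> carrier A \<and> \<one>\<^bsub>A\<^esub> \<in> carrier A \<and> (\<forall>q. cst A q \<in> carrier A)"

definition RGA :: "'a ralg set" where
  "RGA = {A. ralg_closed A \<and> goedel_algebra A \<and>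
     (\<forall>p q r. real_of_unit_rat r = real_of_unit_rat p \<otimes>\<^bsub>standard_goedel\<^esub> real_of_unit_rat q
        \<longrightarrow> cst A p \<otimes>\<^bsub>A\<^esub> cst A q = cst A r) \<and>
     (\<forall>p q r. real_of_unit_rat r = real_of_unit_rat p \<leadsto>\<^bsub>standard_goedel\<^esub> real_of_unit_rat q
        \<longrightarrow> cst A p \<leadsto>\<^bsub>A\<^esub> cst A q = cst A r) \<and>
     (\<forall>q. real_of_unit_rat q = 0 \<longrightarrow> cst A q = \<zero>\<^bsub>A\<^esub>) \<and>
     (\<forall>q. real_of_unit_rat q = 1 \<longrightarrow> cst A q = \<one>\<^bsub>A\<^esub>)}"

definition nontrivial :: "'a ralg \<Rightarrow> bool" where
  "nontrivial A \<longleftrightarrow> (\<exists>a\<in>carrier A. \<exists>b\<in>carrier A. a \<noteq> b)"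

definition ralg_hom :: "'a ralg \<Rightarrow> 'b ralg \<Rightarrow> ('a \<Rightarrow> 'b) \<Rightarrow> bool" where
  "ralg_hom A B h \<longleftrightarrow> h \<in> carrier A \<rightarrow> carrier B \<and>
     (\<forall>a\<in>carrier A. \<forall>b\<in>carrier A.
        h (a \<otimes>\<^bsub>A\<^esub> b) = h a \<otimes>\<^bsub>B\<^esub> h b \<and> h (a \<curlywedge>\<^bsub>A\<^esub> b) = h a \<curlywedge>\<^bsub>B\<^esub> h b \<and>
        h (a \<curlyvee>\<^bsub>A\<^esub> b) = h a \<curlyvee>\<^bsub>B\<^esub> h b \<and> h (a \<leadsto>\<^bsub>A\<^esub> b) = h a \<leadsto>\<^bsub>B\<^esub> h b) \<and>
     h \<zero>\<^bsub>A\<^esub> = \<zero>\<^bsub>B\<^esub> \<and> h \<one>\<^bsub>A\<^esub> = \<one>\<^bsub>B\<^esub> \<and> (\<forall>q. h (cst A q) = cst B q)"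

definition embedding :: "'a ralg \<Rightarrow> 'b ralg \<Rightarrow> ('a \<Rightarrow> 'b) \<Rightarrow> bool" where
  "embedding A B h \<longleftrightarrow> ralg_hom A B h \<and> inj_on h (carrier A)"

definition isomorphic :: "'a ralg \<Rightarrow> 'b ralg \<Rightarrow> bool" where
  "isomorphic A B \<longleftrightarrow> (\<exists>h. ralg_hom A B h \<and> bij_betw h (carrier A) (carrier B))"

definition zero_generated :: "'a ralg \<Rightarrow> 'a ralg" where
  "zero_generated A =
     A\<lparr>carrier := \<Inter>{S. S \<subseteq> carrier A \<and> ralg_closed (A\<lparr>carrier := S\<rparr>)}\<rparr>"

section \<open>Formulas, quasivarieties\<close>

datatype fm =
    Var nat | Zero | One | Cst unit_rat
  | Meet fm fm | Join fm fm | Mult fm fm | Imp fm fm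

primrec eval :: "'a ralg \<Rightarrow> (nat \<Rightarrow> 'a) \<Rightarrow> fm \<Rightarrow> 'a" where
  "eval A v (Var n) = v n"
| "eval A v Zero = \<zero>\<^bsub>A\<^esub>"
| "eval A v One = \<one>\<^bsub>A\<^esub>"
| "eval A v (Cst q) = cst A q"
| "eval A v (Meet s t) = eval A v s \<curlywedge>\<^bsub>A\<^esub> eval A v t"
| "eval A v (Join s t) = eval A v s \<curlyvee>\<^bsub>A\<^esub> eval A v t"
| "eval A v (Mult s t) = eval A v s \<otimes>\<^bsub>A\<^esub> eval A v t"
| "eval A v (Imp s t) = eval A v s \<leadsto>\<^bsub>A\<^esub> eval A v t"

primrec subst :: "(nat \<Rightarrow> fm) \<Rightarrow> fm \<Rightarrow> fm" where
  "subst \<sigma> (Var n) = \<sigma> n"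
| "subst \<sigma> Zero = Zero"
| "subst \<sigma> One = One"
| "subst \<sigma> (Cst q) = Cst q"
| "subst \<sigma> (Meet s t) = Meet (subst \<sigma> s) (subst \<sigma> t)"
| "subst \<sigma> (Join s t) = Join (subst \<sigma> s) (subst \<sigma> t)"
| "subst \<sigma> (Mult s t) = Mult (subst \<sigma> s) (subst \<sigma> t)"
| "subst \<sigma> (Imp s t) = Imp (subst \<sigma> s) (subst \<sigma> t)"

type_synonym equation = "fm \<times> fm"

definition sat_eq :: "'a ralg \<Rightarrow> (nat \<Rightarrow> 'a) \<Rightarrow> equation \<Rightarrow> bool" where
  "sat_eq A v e \<longleftrightarrow> eval A v (fst e) = eval A v (snd e)"

definition eq_conseq :: "'a ralg set \<Rightarrow> equation set \<Rightarrow> equation \<Rightarrow> bool" where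
  "eq_conseq K E e \<longleftrightarrow> (\<forall>A\<in>K. \<forall>v. range v \<subseteq> carrier A \<longrightarrow>
     (\<forall>d\<in>E. sat_eq A v d) \<longrightarrow> sat_eq A v e)"

text \<open>A class of algebras is represented by its members whose universe is a subset of the type
  \<open>'a\<close>, which should be infinite: the language is countable, so every countable algebra then
  has a copy over \<open>'a\<close>, and a subalgebra generated by two members over \<open>'a\<close> has one, too.
  A quasivariety is the class of all models of a set of quasi-equations.\<close>

definition quasivariety :: "'a ralg set \<Rightarrow> bool" where
  "quasivariety K \<longleftrightarrow> (\<exists>Q. (\<forall>(E, e)\<in>Q. finite E) \<and>
     K = {A. ralg_closed A \<and> (\<forall>(E, e)\<in>Q. eq_conseq {A} E e)})"

definition joint_embedding :: "'a ralg set \<Rightarrow> bool" where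
  "joint_embedding K \<longleftrightarrow> (\<forall>A\<in>K. \<forall>B\<in>K. nontrivial A \<longrightarrow> nontrivial B \<longrightarrow>
     (\<exists>C\<in>K. (\<exists>f. embedding A C f) \<and> (\<exists>g. embedding B C g)))"

definition isomorphic_zero_generated :: "'a ralg set \<Rightarrow> bool" where
  "isomorphic_zero_generated K \<longleftrightarrow> (\<forall>A\<in>K. \<forall>B\<in>K. nontrivial A \<longrightarrow> nontrivial B \<longrightarrow>
     isomorphic (zero_generated A) (zero_generated B))"

section \<open>Logics\<close>

definition logic :: "(fm set \<Rightarrow> fm \<Rightarrow> bool) \<Rightarrow> bool" where
  "logic L \<longleftrightarrow>
     (\<forall>\<Gamma> \<phi>. \<phi> \<in> \<Gamma> \<longrightarrow> L \<Gamma> \<phi>) \<and>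
     (\<forall>\<Gamma> \<Delta> \<phi>. (\<forall>\<delta>\<in>\<Delta>. L \<Gamma> \<delta>) \<longrightarrow> L \<Delta> \<phi> \<longrightarrow> L \<Gamma> \<phi>) \<and>
     (\<forall>\<Gamma> \<phi>. L \<Gamma> \<phi> \<longrightarrow> (\<exists>\<Delta>\<subseteq>\<Gamma>. finite \<Delta> \<and> L \<Delta> \<phi>)) \<and>
     (\<forall>\<sigma> \<Gamma> \<phi>. L \<Gamma> \<phi> \<longrightarrow> L (subst \<sigma> ` \<Gamma>) (subst \<sigma> \<phi>))"

definition true_eq :: "fm \<Rightarrow> equation" where
  "true_eq \<phi> = (\<phi>, One)"

text \<open>Only the countable members of \<open>RGA\<close> enter this definition, those with universe in
  \<open>nat\<close>. The lemma \<open>RG_sound\<close> below shows that nothing is lost.\<close>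

definition RG :: "fm set \<Rightarrow> fm \<Rightarrow> bool" where
  "RG \<Gamma> \<phi> \<longleftrightarrow> (\<exists>\<Delta>\<subseteq>\<Gamma>. finite \<Delta> \<and>
     eq_conseq (RGA :: nat ralg set) (true_eq ` \<Delta>) (true_eq \<phi>))"

definition extension_of_RG :: "(fm set \<Rightarrow> fm \<Rightarrow> bool) \<Rightarrow> bool" where
  "extension_of_RG L \<longleftrightarrow> logic L \<and> (\<forall>\<Gamma> \<phi>. RG \<Gamma> \<phi> \<longrightarrow> L \<Gamma> \<phi>)"

definition equiv_fm :: "fm \<Rightarrow> fm \<Rightarrow> fm" where
  "equiv_fm s t = Meet (Imp s t) (Imp t s)"

text \<open>Algebraization in the sense of Blok and Pigozzi, with defining equation \<open>x \<approx> 1\<close> and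
  equivalence formula \<open>(x \<rightarrow> y) \<and> (y \<rightarrow> x)\<close>.\<close>

definition algebraized_by :: "(fm set \<Rightarrow> fm \<Rightarrow> bool) \<Rightarrow> 'a ralg set \<Rightarrow> bool" where
  "algebraized_by L K \<longleftrightarrow> quasivariety K \<and> K \<subseteq> RGA \<and>
     (\<forall>\<Gamma> \<phi>. L \<Gamma> \<phi> \<longleftrightarrow> eq_conseq K (true_eq ` \<Gamma>) (true_eq \<phi>)) \<and>
     (\<forall>s t. eq_conseq K {(s, t)} (true_eq (equiv_fm s t)) \<and>
            eq_conseq K {true_eq (equiv_fm s t)} (s, t))"

definition passive_premises :: "(fm set \<Rightarrow> fm \<Rightarrow> bool) \<Rightarrow> fm set \<Rightarrow> bool" where
  "passive_premises L \<Gamma> \<longleftrightarrow> \<not> (\<exists>\<sigma>. \<forall>\<gamma>\<in>\<Gamma>. L {} (subst \<sigma> \<gamma>))"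

definition passively_structurally_complete :: "(fm set \<Rightarrow> fm \<Rightarrow> bool) \<Rightarrow> bool" where
  "passively_structurally_complete L \<longleftrightarrow>
     (\<forall>\<Gamma> \<phi>. finite \<Gamma> \<longrightarrow> passive_premises L \<Gamma> \<longrightarrow> L \<Gamma> \<phi>)"

section \<open>Independence of \<open>RG\<close> from the carrier type\<close>

lemma eval_closed:
  assumes "ralg_closed A" "range v \<subseteq> carrier A"
  shows "eval A v \<phi> \<in> carrier A"
  using assms by (induction \<phi>) (auto simp: ralg_closed_def)

lemma eval_hom:
  assumes "ralg_closed A" "ralg_hom A B h" "range v \<subseteq> carrier A"
  shows "eval B (h \<circ> v) \<phi> = h (eval A v \<phi>)"
  by (induction \<phi>) (use assms eval_closed[OF assms(1,3)] in \<open>auto simp: ralg_hom_def\<close>)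

lemma bl_eval_closed:
  assumes "ralg_closed A" "range v \<subseteq> carrier A"
  shows "bl_eval A v \<phi> \<in> carrier A"
  using assms by (induction \<phi>) (auto simp: ralg_closed_def)

lemma bl_eval_hom:
  assumes "ralg_closed A" "ralg_hom A B h" "range v \<subseteq> carrier A"
  shows "bl_eval B (h \<circ> v) \<phi> = h (bl_eval A v \<phi>)"
  by (induction \<phi>) (use assms bl_eval_closed[OF assms(1,3)] in \<open>auto simp: ralg_hom_def\<close>)

lemma bl_algebra_embedding:
  assumes A: "ralg_closed A" and h: "embedding A B h" and B: "bl_algebra B"
  shows "bl_algebra A"
proof -
  interpret B: bl_algebra B by (rule B)
  have inj: "a = b" if "h a = h b" "a \<in> carrier A" "b \<in> carrier A" for a b
    using that h by (auto simp: embedding_def inj_on_def)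
  have iff: "h a = h b \<longleftrightarrow> a = b" if "a \<in> carrier A" "b \<in> carrier A" for a b
    using that inj by blast
  have cl: "h a \<in> carrier B" if "a \<in> carrier A" for a
    using that h by (auto simp: embedding_def ralg_hom_def)
  note hs = h[unfolded embedding_def ralg_hom_def] A[unfolded ralg_closed_def]
  have hm: "h (a \<otimes>\<^bsub>A\<^esub> b) = h a \<otimes>\<^bsub>B\<^esub> h b" "h (a \<curlywedge>\<^bsub>A\<^esub> b) = h a \<curlywedge>\<^bsub>B\<^esub> h b"
      "h (a \<curlyvee>\<^bsub>A\<^esub> b) = h a \<curlyvee>\<^bsub>B\<^esub> h b" "h (a \<leadsto>\<^bsub>A\<^esub> b) = h a \<leadsto>\<^bsub>B\<^esub> h b"
      "a \<otimes>\<^bsub>A\<^esub> b \<in> carrier A" "a \<curlywedge>\<^bsub>A\<^esub> b \<in> carrier A"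
      "a \<curlyvee>\<^bsub>A\<^esub> b \<in> carrier A" "a \<leadsto>\<^bsub>A\<^esub> b \<in> carrier A"
    if "a \<in> carrier A" "b \<in> carrier A" for a b
    using hs that by auto
  have h01: "h \<zero>\<^bsub>A\<^esub> = \<zero>\<^bsub>B\<^esub>" "h \<one>\<^bsub>A\<^esub> = \<one>\<^bsub>B\<^esub>" "\<zero>\<^bsub>A\<^esub> \<in> carrier A" "\<one>\<^bsub>A\<^esub> \<in> carrier A"
    using hs by auto
  note S = hm h01 cl
  show ?thesis
  proof unfold_locales
    fix a b c assume abc: "a \<in> carrier A" "b \<in> carrier A" "c \<in> carrier A"
    show "a \<otimes>\<^bsub>A\<^esub> b \<otimes>\<^bsub>A\<^esub> c = a \<otimes>\<^bsub>A\<^esub> (b \<otimes>\<^bsub>A\<^esub> c)"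
      by (rule inj) (use abc in \<open>simp_all add: S B.m_assoc\<close>)
    show "(a \<curlywedge>\<^bsub>A\<^esub> b) \<curlywedge>\<^bsub>A\<^esub> c = a \<curlywedge>\<^bsub>A\<^esub> (b \<curlywedge>\<^bsub>A\<^esub> c)"
      by (rule inj) (use abc in \<open>simp_all add: S B.meet_assoc\<close>)
    show "(a \<curlyvee>\<^bsub>A\<^esub> b) \<curlyvee>\<^bsub>A\<^esub> c = a \<curlyvee>\<^bsub>A\<^esub> (b \<curlyvee>\<^bsub>A\<^esub> c)"
      by (rule inj) (use abc in \<open>simp_all add: S B.join_assoc\<close>)
    show "bl_le A (a \<otimes>\<^bsub>A\<^esub> b) c \<longleftrightarrow> bl_le A a (b \<leadsto>\<^bsub>A\<^esub> c)"
      using abc B.residuation[of "h a" "h b" "h c"] iff[of "(a \<otimes>\<^bsub>A\<^esub> b) \<curlywedge>\<^bsub>A\<^esub> c" "a \<otimes>\<^bsub>A\<^esub> b"]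
        iff[of "a \<curlywedge>\<^bsub>A\<^esub> (b \<leadsto>\<^bsub>A\<^esub> c)" a] by (simp add: S)
  next
    fix a b assume abc: "a \<in> carrier A" "b \<in> carrier A"
    show "a \<otimes>\<^bsub>A\<^esub> b = b \<otimes>\<^bsub>A\<^esub> a"
      by (rule inj) (use abc in \<open>simp_all add: S B.m_comm\<close>)
    show "a \<curlywedge>\<^bsub>A\<^esub> b = b \<curlywedge>\<^bsub>A\<^esub> a"
      by (rule inj) (use abc B.meet_comm[of "h a" "h b"] in \<open>simp_all add: S\<close>)
    show "a \<curlyvee>\<^bsub>A\<^esub> b = b \<curlyvee>\<^bsub>A\<^esub> a"
      by (rule inj) (use abc B.join_comm[of "h a" "h b"] in \<open>simp_all add: S\<close>)
    show "a \<curlywedge>\<^bsub>A\<^esub> (a \<curlyvee>\<^bsub>A\<^esub> b) = a"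
      by (rule inj) (use abc in \<open>simp_all add: S B.meet_absorb\<close>)
    show "a \<curlyvee>\<^bsub>A\<^esub> (a \<curlywedge>\<^bsub>A\<^esub> b) = a"
      by (rule inj) (use abc in \<open>simp_all add: S B.join_absorb\<close>)
    show "(a \<leadsto>\<^bsub>A\<^esub> b) \<curlyvee>\<^bsub>A\<^esub> (b \<leadsto>\<^bsub>A\<^esub> a) = \<one>\<^bsub>A\<^esub>"
      by (rule inj) (use abc in \<open>simp_all add: S B.prelinearity\<close>)
    show "a \<curlywedge>\<^bsub>A\<^esub> b = a \<otimes>\<^bsub>A\<^esub> (a \<leadsto>\<^bsub>A\<^esub> b)"
      by (rule inj) (use abc B.divisibility[of "h a" "h b"] in \<open>simp_all add: S\<close>)
  next
    fix a assume a: "a \<in> carrier A"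
    show "\<one>\<^bsub>A\<^esub> \<otimes>\<^bsub>A\<^esub> a = a" by (rule inj) (use a in \<open>simp_all add: S\<close>)
    show "a \<otimes>\<^bsub>A\<^esub> \<one>\<^bsub>A\<^esub> = a" by (rule inj) (use a in \<open>simp_all add: S\<close>)
    show "bl_le A \<zero>\<^bsub>A\<^esub> a" by (rule inj) (use a in \<open>simp_all add: S B.zero_least\<close>)
    show "bl_le A a \<one>\<^bsub>A\<^esub>" by (rule inj) (use a in \<open>simp_all add: S B.one_greatest\<close>)
  qed (use S in auto)
qed

lemma RGA_embedding:
  assumes A: "ralg_closed A" and h: "embedding A B h" and B: "B \<in> RGA"
  shows "A \<in> RGA"
proof -
  have hom: "ralg_hom A B h" and inj: "inj_on h (carrier A)"
    using h by (auto simp: embedding_def)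
  have cstA: "cst A q \<in> carrier A" "\<zero>\<^bsub>A\<^esub> \<in> carrier A" "\<one>\<^bsub>A\<^esub> \<in> carrier A" for q
    using A by (auto simp: ralg_closed_def)
  have opA: "cst A p \<otimes>\<^bsub>A\<^esub> cst A q \<in> carrier A" "cst A p \<leadsto>\<^bsub>A\<^esub> cst A q \<in> carrier A" for p q
    using A by (auto simp: ralg_closed_def)
  have hop: "h (cst A p \<otimes>\<^bsub>A\<^esub> cst A q) = cst B p \<otimes>\<^bsub>B\<^esub> cst B q"
      "h (cst A p \<leadsto>\<^bsub>A\<^esub> cst A q) = cst B p \<leadsto>\<^bsub>B\<^esub> cst B q" for p q
    using hom cstA by (auto simp: ralg_hom_def)
  have hc: "h (cst A q) = cst B q" "h \<zero>\<^bsub>A\<^esub> = \<zero>\<^bsub>B\<^esub>" "h \<one>\<^bsub>A\<^esub> = \<one>\<^bsub>B\<^esub>" for q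
    using hom by (auto simp: ralg_hom_def)
  have ident: "bl_identity A s t" if "bl_identity B s t" for s t
    unfolding bl_identity_def
  proof (intro allI impI)
    fix v :: "nat \<Rightarrow> 'a" assume v: "range v \<subseteq> carrier A"
    have "range (h \<circ> v) \<subseteq> carrier B" using v hom by (auto simp: ralg_hom_def)
    with that have "bl_eval B (h \<circ> v) s = bl_eval B (h \<circ> v) t"
      by (auto simp: bl_identity_def)
    then have "h (bl_eval A v s) = h (bl_eval A v t)"
      by (simp add: bl_eval_hom[OF A hom v])
    then show "bl_eval A v s = bl_eval A v t"
      using inj bl_eval_closed[OF A v] by (auto dest: inj_onD)
  qed
  have "goedel_algebra A"
    using B ident bl_algebra_embedding[OF A h] by (auto simp: RGA_def goedel_algebra_def)
  moreover have "cst A p \<otimes>\<^bsub>A\<^esub> cst A q = cst A r"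
    if "real_of_unit_rat r = real_of_unit_rat p \<otimes>\<^bsub>standard_goedel\<^esub> real_of_unit_rat q" for p q r
    by (rule inj_onD[OF inj]) (use B that in \<open>auto simp: RGA_def hop hc cstA opA\<close>)
  moreover have "cst A p \<leadsto>\<^bsub>A\<^esub> cst A q = cst A r"
    if "real_of_unit_rat r = real_of_unit_rat p \<leadsto>\<^bsub>standard_goedel\<^esub> real_of_unit_rat q" for p q r
    by (rule inj_onD[OF inj]) (use B that in \<open>auto simp: RGA_def hop hc cstA opA\<close>)
  moreover have "cst A q = \<zero>\<^bsub>A\<^esub>" if "real_of_unit_rat q = 0" for q
    by (rule inj_onD[OF inj]) (use B that in \<open>auto simp: RGA_def hc cstA\<close>)
  moreover have "cst A q = \<one>\<^bsub>A\<^esub>" if "real_of_unit_rat q = 1" for q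
    by (rule inj_onD[OF inj]) (use B that in \<open>auto simp: RGA_def hc cstA\<close>)
  ultimately show ?thesis using A by (simp add: RGA_def)
qed

instance unit_rat :: countable
proof
  show "\<exists>to_nat :: unit_rat \<Rightarrow> nat. inj to_nat"
    by (rule exI[of _ "to_nat \<circ> Rep_unit_rat"]) (auto simp: inj_def Rep_unit_rat_inject)
qed

instance fm :: countable
  by countable_datatype

lemma RG_sound:
  fixes A :: "'a ralg"
  assumes RG: "RG \<Gamma> \<phi>" and A: "A \<in> RGA" and v: "range v \<subseteq> carrier A"
    and \<Gamma>: "\<forall>\<gamma>\<in>\<Gamma>. sat_eq A v (true_eq \<gamma>)"
  shows "sat_eq A v (true_eq \<phi>)"
proof -
  define S where "S = range (eval A v)"
  define f where "f = to_nat_on S"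
  define g where "g = inv_into S f"
  have clA: "ralg_closed A" using A by (simp add: RGA_def)
  have "countable S" unfolding S_def by simp
  then have injf: "inj_on f S" unfolding f_def by (rule inj_on_to_nat_on)
  have SA: "S \<subseteq> carrier A" using eval_closed[OF clA v] by (auto simp: S_def)
  have gf: "g (f x) = x" if "x \<in> S" for x using that injf by (simp add: g_def)
  have Sc: "\<zero>\<^bsub>A\<^esub> \<in> S" "\<one>\<^bsub>A\<^esub> \<in> S" "cst A q \<in> S" "v n \<in> S" for q n
    unfolding S_def by (rule range_eqI[where x = Zero] range_eqI[where x = One]
      range_eqI[where x = "Cst q"] range_eqI[where x = "Var n"]; simp)+
  have So: "x \<otimes>\<^bsub>A\<^esub> y \<in> S \<and> x \<curlywedge>\<^bsub>A\<^esub> y \<in> S \<and> x \<curlyvee>\<^bsub>A\<^esub> y \<in> S \<and> x \<leadsto>\<^bsub>A\<^esub> y \<in> S"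
    if xy: "x \<in> S" "y \<in> S" for x y
  proof -
    obtain s t where "x = eval A v s" "y = eval A v t"
      using xy by (auto simp: S_def)
    then have "x \<otimes>\<^bsub>A\<^esub> y = eval A v (Mult s t)" "x \<curlywedge>\<^bsub>A\<^esub> y = eval A v (Meet s t)"
      "x \<curlyvee>\<^bsub>A\<^esub> y = eval A v (Join s t)" "x \<leadsto>\<^bsub>A\<^esub> y = eval A v (Imp s t)" by simp_all
    then show ?thesis unfolding S_def by blast
  qed
  define B :: "nat ralg" where
    "B = \<lparr>carrier = f ` S, monoid.mult = (\<lambda>x y. f (g x \<otimes>\<^bsub>A\<^esub> g y)), one = f \<one>\<^bsub>A\<^esub>,
       bmeet = (\<lambda>x y. f (g x \<curlywedge>\<^bsub>A\<^esub> g y)), bjoin = (\<lambda>x y. f (g x \<curlyvee>\<^bsub>A\<^esub> g y)),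
       bimp = (\<lambda>x y. f (g x \<leadsto>\<^bsub>A\<^esub> g y)), bzero = f \<zero>\<^bsub>A\<^esub>, cst = (\<lambda>q. f (cst A q))\<rparr>"
  have clB: "ralg_closed B"
    using So Sc by (auto simp: ralg_closed_def B_def gf)
  have homg: "ralg_hom B A g"
    using So Sc SA by (auto simp: ralg_hom_def B_def gf)
  moreover have "inj_on g (carrier B)"
    by (auto simp: B_def gf inj_on_def)
  ultimately have emb: "embedding B A g" by (simp add: embedding_def)
  have BR: "B \<in> RGA" by (rule RGA_embedding[OF clB emb A])
  have fv: "range (f \<circ> v) \<subseteq> carrier B" using Sc by (auto simp: B_def)
  have gfv: "g \<circ> (f \<circ> v) = v" using Sc by (auto simp: gf fun_eq_iff)
  have ev: "g (eval B (f \<circ> v) \<psi>) = eval A v \<psi>" for \<psi>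
    using eval_hom[OF clB homg fv, of \<psi>] by (simp add: gfv)
  have one: "sat_eq B (f \<circ> v) (true_eq \<psi>) \<longleftrightarrow> sat_eq A v (true_eq \<psi>)" for \<psi>
    using ev[of \<psi>] ev[of One] eval_closed[OF clB fv] \<open>inj_on g (carrier B)\<close>
    unfolding sat_eq_def true_eq_def fst_conv snd_conv by (metis inj_onD)
  from RG obtain \<Delta> where "\<Delta> \<subseteq> \<Gamma>"
    "eq_conseq (RGA :: nat ralg set) (true_eq ` \<Delta>) (true_eq \<phi>)"
    by (auto simp: RG_def)
  then have "(\<forall>\<gamma>\<in>\<Delta>. sat_eq B (f \<circ> v) (true_eq \<gamma>)) \<longrightarrow> sat_eq B (f \<circ> v) (true_eq \<phi>)"
    using BR fv unfolding eq_conseq_def by blast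
  then show ?thesis using \<open>\<Delta> \<subseteq> \<Gamma>\<close> \<Gamma> one by blast
qed

section \<open>The algebraizing quasivariety\<close>

text \<open>A quasivariety that algebraizes \<open>L\<close> is unique: it consists of the rational Goedel
  algebras that validate all rules derivable in \<open>L\<close>.\<close>

lemma bl_algebra_standard_goedel: "bl_algebra standard_goedel"
  by unfold_locales (auto simp: standard_goedel_def min_def max_def Units_def)

lemma sat_true_eq_equiv_fm:
  assumes A: "A \<in> RGA" and v: "range v \<subseteq> carrier A"
  shows "sat_eq A v (true_eq (equiv_fm s t)) \<longleftrightarrow> sat_eq A v (s, t)"
proof -
  interpret bl_algebra A using A by (simp add: RGA_def goedel_algebra_def)
  define a where "a = eval A v s"
  define b where "b = eval A v t"
  have cl: "a \<in> carrier A" "b \<in> carrier A"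
    using A v by (auto simp: a_def b_def RGA_def intro!: eval_closed)
  have top: "\<one>\<^bsub>A\<^esub> \<curlywedge>\<^bsub>A\<^esub> x = x" if "x \<in> carrier A" for x
    using one_greatest[OF that] meet_comm[OF that one_closed] by simp
  have le: "x \<leadsto>\<^bsub>A\<^esub> y = \<one>\<^bsub>A\<^esub> \<longleftrightarrow> bl_le A x y" if "x \<in> carrier A" "y \<in> carrier A" for x y
    using residuation[OF one_closed that] that top imp_closed by auto
  have meet1: "x \<curlywedge>\<^bsub>A\<^esub> y = \<one>\<^bsub>A\<^esub> \<longleftrightarrow> x = \<one>\<^bsub>A\<^esub> \<and> y = \<one>\<^bsub>A\<^esub>"
    if xy: "x \<in> carrier A" "y \<in> carrier A" for x y
  proof
    assume m: "x \<curlywedge>\<^bsub>A\<^esub> y = \<one>\<^bsub>A\<^esub>"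
    have "x = \<one>\<^bsub>A\<^esub>" using join_absorb[OF xy] m join_comm[of x "\<one>\<^bsub>A\<^esub>"] xy
        join_absorb[OF one_closed xy(1)] top[OF xy(1)] by simp
    then show "x = \<one>\<^bsub>A\<^esub> \<and> y = \<one>\<^bsub>A\<^esub>" using m top[OF xy(2)] by simp
  qed (use top in auto)
  have "(a \<leadsto>\<^bsub>A\<^esub> b) \<curlywedge>\<^bsub>A\<^esub> (b \<leadsto>\<^bsub>A\<^esub> a) = \<one>\<^bsub>A\<^esub> \<longleftrightarrow> bl_le A a b \<and> bl_le A b a"
    using cl by (simp add: meet1 le imp_closed)
  also have "\<dots> \<longleftrightarrow> a = b"
  proof
    assume "a = b"
    have "bl_le A a a"
      using meet_absorb[OF cl(1) meet_closed[OF cl(1) cl(1)]] join_absorb[OF cl(1) cl(1)] by simp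
    with \<open>a = b\<close> show "bl_le A a b \<and> bl_le A b a" by simp
  qed (use meet_comm[OF cl] in auto)
  finally show ?thesis by (simp add: sat_eq_def true_eq_def equiv_fm_def a_def b_def)
qed

lemma algebraized_by_unique:
  assumes "algebraized_by L K"
  shows "K = {A \<in> RGA. \<forall>\<Gamma> \<phi>. finite \<Gamma> \<longrightarrow> L \<Gamma> \<phi> \<longrightarrow>
    (\<forall>v. range v \<subseteq> carrier A \<longrightarrow> (\<forall>\<gamma>\<in>\<Gamma>. eval A v \<gamma> = \<one>\<^bsub>A\<^esub>) \<longrightarrow> eval A v \<phi> = \<one>\<^bsub>A\<^esub>)}"
    (is "K = ?M")
proof
  have K: "K \<subseteq> RGA" and L: "L \<Gamma> \<phi> \<longleftrightarrow> eq_conseq K (true_eq ` \<Gamma>) (true_eq \<phi>)" for \<Gamma> \<phi>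
    using assms by (auto simp: algebraized_by_def)
  show "K \<subseteq> ?M"
    using K by (auto simp: L eq_conseq_def sat_eq_def true_eq_def)
  obtain Q where fin: "\<forall>(E, e)\<in>Q. finite E"
    and Q: "K = {A. ralg_closed A \<and> (\<forall>(E, e)\<in>Q. eq_conseq {A} E e)}"
    using assms by (auto simp: algebraized_by_def quasivariety_def)
  show "?M \<subseteq> K"
  proof
    fix A assume AM: "A \<in> ?M"
    then have A: "A \<in> RGA" by simp
    have "eq_conseq {A} E e" if "(E, e) \<in> Q" for E e
      unfolding eq_conseq_def
    proof (intro ballI allI impI)
      fix A' v assume "A' \<in> {A}" and v': "range v \<subseteq> carrier A'" and E': "\<forall>d\<in>E. sat_eq A' v d"
      then have v: "range v \<subseteq> carrier A" and E: "\<forall>d\<in>E. sat_eq A v d" and A': "A' = A" by auto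
      let ?\<Gamma> = "(\<lambda>(s, t). equiv_fm s t) ` E"
      have "eq_conseq K E e" using that Q by (auto simp: eq_conseq_def)
      then have "L ?\<Gamma> (equiv_fm (fst e) (snd e))"
        unfolding L eq_conseq_def
      proof (intro ballI allI impI)
        fix C w assume C: "C \<in> K" and w: "range w \<subseteq> carrier C"
          and prem: "\<forall>d\<in>true_eq ` ?\<Gamma>. sat_eq C w d"
        have CR: "C \<in> RGA" using C K by blast
        have "sat_eq C w (s, t)" if "(s, t) \<in> E" for s t
          using prem that sat_true_eq_equiv_fm[OF CR w, of s t] by force
        then have "\<forall>d\<in>E. sat_eq C w d" by auto
        then have "sat_eq C w e"
          using \<open>eq_conseq K E e\<close> C w unfolding eq_conseq_def by blast
        then show "sat_eq C w (true_eq (equiv_fm (fst e) (snd e)))"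
          using sat_true_eq_equiv_fm[OF CR w, of "fst e" "snd e"] by simp
      qed
      moreover have "finite ?\<Gamma>" using fin that by auto
      moreover have "\<forall>\<gamma>\<in>?\<Gamma>. eval A v \<gamma> = \<one>\<^bsub>A\<^esub>"
        using E sat_true_eq_equiv_fm[OF A v] by (auto simp: sat_eq_def true_eq_def)
      ultimately have "eval A v (equiv_fm (fst e) (snd e)) = \<one>\<^bsub>A\<^esub>"
        using AM v by blast
      then show "sat_eq A' v e"
        using sat_true_eq_equiv_fm[OF A v, of "fst e" "snd e"] A' by (simp add: sat_eq_def true_eq_def)
    qed
    then show "A \<in> K" using A by (auto simp: Q RGA_def)
  qed
qed

end

theory Submission
  imports Defs
begin

text \<open>Collapsing an upper set of constants to 1 determines the zero-generated subalgebra of a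
  rational Goedel algebra \<open>A\<close>, so its isomorphism type is recorded by \<open>tops A\<close>, the set of
  constants that equal 1 in \<open>A\<close>, and all three conditions say that \<open>tops\<close> is the same for all
  nontrivial members of the algebraizing quasivariety. If \<open>q \<in> tops A - tops B\<close>, then the passive
  rule with premise \<open>Cst q\<close> and conclusion \<open>Zero\<close> fails in \<open>A\<close>, and no algebra extends both.
  Conversely, finitely many equations that are solvable in a nontrivial \<open>A\<close> are already solvable
  by constants of \<open>A\<close>. If \<open>tops\<close> is the same everywhere, such a solution is a substitution into
  theorems, so premises satisfiable in a nontrivial algebra are never passive; and it shows that
  the diagrams of two algebras are jointly consistent.\<close>

section \<open>Constants of rational Goedel algebras\<close>

text \<open>That equations solvable in A are solvable by its constants is shown without decomposing
  A into chains. A enters through the identities of [0,1]: if no valuation in [0,1] put the finitely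
  many premises strictly above a term t, the implication from their meet to t would be an identity
  of [0,1], hence of A. The gap obtained is strict, so the value s of t can serve as a threshold:
  replacing everything above s by 1 imitates what A does to the constants in \<open>tops A\<close>,
  and density of the rationals moves the finitely many other values to constants. Such a solution is
  found for each finite set of equations separately. The common extension is therefore built from
  terms modulo those equations that follow from finitely many diagram equations; compactness is thus
  part of the construction. A further constraint is that all algebras must live on the prescribed
  type \<open>'a\<close>. Quotients of term algebras are moved there by choosing representatives and
  coding terms injectively, and this is where infinity of \<open>'a\<close> enters.\<close>

lemma real_of_unit_rat_bounds: "0 \<le> real_of_unit_rat q" "real_of_unit_rat q \<le> 1"
  using Rep_unit_rat[of q] by (auto simp: real_of_unit_rat_def)

lemma real_of_unit_rat_inject: "real_of_unit_rat p = real_of_unit_rat q \<longleftrightarrow> p = q"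
  by (simp add: real_of_unit_rat_def Rep_unit_rat_inject)

definition unit_rat_0 :: unit_rat where
  "unit_rat_0 = Abs_unit_rat 0"

definition unit_rat_1 :: unit_rat where
  "unit_rat_1 = Abs_unit_rat 1"

lemma real_of_unit_rat_0: "real_of_unit_rat unit_rat_0 = 0"
  by (simp add: real_of_unit_rat_def unit_rat_0_def Abs_unit_rat_inverse)

lemma real_of_unit_rat_1: "real_of_unit_rat unit_rat_1 = 1"
  by (simp add: real_of_unit_rat_def unit_rat_1_def Abs_unit_rat_inverse)

text \<open>The rational subalgebra of [0,1]_G, each constant naming itself. Every member A of
  \<open>RGA\<close> receives the homomorphism \<open>cst A\<close> from it, so computations with
  constants can be done here. Comparisons go through the reals because \<open>unit_rat\<close>
  carries no order.\<close>

definition rational_goedel :: "unit_rat ralg" where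
  "rational_goedel = \<lparr>carrier = UNIV,
     monoid.mult = (\<lambda>p q. if real_of_unit_rat p \<le> real_of_unit_rat q then p else q),
     one = unit_rat_1,
     bmeet = (\<lambda>p q. if real_of_unit_rat p \<le> real_of_unit_rat q then p else q),
     bjoin = (\<lambda>p q. if real_of_unit_rat p \<le> real_of_unit_rat q then q else p),
     bimp = (\<lambda>p q. if real_of_unit_rat p \<le> real_of_unit_rat q then unit_rat_1 else q),
     bzero = unit_rat_0, cst = id\<rparr>"

lemma rational_goedel_simps:
  "carrier rational_goedel = UNIV" "\<zero>\<^bsub>rational_goedel\<^esub> = unit_rat_0" "\<one>\<^bsub>rational_goedel\<^esub> = unit_rat_1"
  "p \<otimes>\<^bsub>rational_goedel\<^esub> q = (if real_of_unit_rat p \<le> real_of_unit_rat q then p else q)"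
  "p \<curlywedge>\<^bsub>rational_goedel\<^esub> q = (if real_of_unit_rat p \<le> real_of_unit_rat q then p else q)"
  "p \<curlyvee>\<^bsub>rational_goedel\<^esub> q = (if real_of_unit_rat p \<le> real_of_unit_rat q then q else p)"
  "p \<leadsto>\<^bsub>rational_goedel\<^esub> q = (if real_of_unit_rat p \<le> real_of_unit_rat q then unit_rat_1 else q)"
  by (simp_all add: rational_goedel_def)

lemma rational_goedel_closed: "ralg_closed rational_goedel"
  by (simp add: ralg_closed_def rational_goedel_def)

lemma goedel_mult_eq_meet:
  assumes "goedel_algebra A" "a \<in> carrier A" "b \<in> carrier A"
  shows "a \<otimes>\<^bsub>A\<^esub> b = a \<curlywedge>\<^bsub>A\<^esub> b"
proof -
  have "bl_identity standard_goedel (BMult (BVar 0) (BVar 1)) (BMeet (BVar 0) (BVar 1))"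
    by (simp add: bl_identity_def standard_goedel_def)
  then have "bl_identity A (BMult (BVar 0) (BVar 1)) (BMeet (BVar 0) (BVar 1))"
    using assms(1) by (simp add: goedel_algebra_def)
  then show ?thesis
    unfolding bl_identity_def using assms(2,3)
    by (auto dest!: spec[of _ "\<lambda>n. if n = 0 then a else b"])
qed

lemma (in bl_algebra) one_imp: "a \<in> carrier A \<Longrightarrow> \<one> \<leadsto> a = a"
  using divisibility[of \<one> a] meet_comm[of \<one> a] one_greatest[of a] imp_closed[of \<one> a] by simp

lemma (in bl_algebra) join_eq_right:
  "\<lbrakk>a \<in> carrier A; b \<in> carrier A; bl_le A a b\<rbrakk> \<Longrightarrow> a \<curlyvee> b = b"
  using join_absorb[of b a] meet_comm[of a b] join_comm[of a b] by simp

text \<open>The equations defining \<open>RGA\<close> mention product and implication only. Meet is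
  product in a Goedel algebra, and join follows because the meets determine the order of the
  constants.\<close>

lemma cst_hom:
  assumes A: "A \<in> RGA"
  shows "ralg_hom rational_goedel A (cst A)"
proof -
  interpret bl_algebra A using A by (simp add: RGA_def goedel_algebra_def)
  have G: "goedel_algebra A" and cl: "cst A q \<in> carrier A" for q
    using A by (auto simp: RGA_def ralg_closed_def)
  have mult: "cst A p \<otimes>\<^bsub>A\<^esub> cst A q =
      cst A (if real_of_unit_rat p \<le> real_of_unit_rat q then p else q)" for p q
    using A by (auto simp: RGA_def standard_goedel_def)
  then have meet: "cst A p \<curlywedge>\<^bsub>A\<^esub> cst A q =
      cst A (if real_of_unit_rat p \<le> real_of_unit_rat q then p else q)" for p q
    using goedel_mult_eq_meet[OF G cl cl] by metis
  have imp: "cst A p \<leadsto>\<^bsub>A\<^esub> cst A q =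
      cst A (if real_of_unit_rat p \<le> real_of_unit_rat q then unit_rat_1 else q)" for p q
    using A real_of_unit_rat_1 by (auto simp: RGA_def standard_goedel_def)
  have join: "cst A p \<curlyvee>\<^bsub>A\<^esub> cst A q =
      cst A (if real_of_unit_rat p \<le> real_of_unit_rat q then q else p)" for p q
  proof (cases "real_of_unit_rat p \<le> real_of_unit_rat q")
    case True
    then show ?thesis using join_eq_right[OF cl cl] meet[of p q] by simp
  next
    case False
    then show ?thesis using join_eq_right[OF cl cl, of q p] meet[of q p] join_comm[OF cl cl, of p q] by simp
  qed
  have "cst A unit_rat_0 = \<zero>\<^bsub>A\<^esub>" "cst A unit_rat_1 = \<one>\<^bsub>A\<^esub>"
    using A real_of_unit_rat_0 real_of_unit_rat_1 by (auto simp: RGA_def)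
  then show ?thesis
    using cl mult meet imp join by (auto simp: ralg_hom_def rational_goedel_def)
qed

lemma cst_ops:
  assumes "A \<in> RGA"
  shows "cst A p \<otimes>\<^bsub>A\<^esub> cst A q = cst A (p \<otimes>\<^bsub>rational_goedel\<^esub> q)"
    "cst A p \<curlywedge>\<^bsub>A\<^esub> cst A q = cst A (p \<curlywedge>\<^bsub>rational_goedel\<^esub> q)"
    "cst A p \<curlyvee>\<^bsub>A\<^esub> cst A q = cst A (p \<curlyvee>\<^bsub>rational_goedel\<^esub> q)"
    "cst A p \<leadsto>\<^bsub>A\<^esub> cst A q = cst A (p \<leadsto>\<^bsub>rational_goedel\<^esub> q)"
    "cst A unit_rat_0 = \<zero>\<^bsub>A\<^esub>" "cst A unit_rat_1 = \<one>\<^bsub>A\<^esub>"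
proof -
  show "cst A p \<otimes>\<^bsub>A\<^esub> cst A q = cst A (p \<otimes>\<^bsub>rational_goedel\<^esub> q)"
    "cst A p \<curlywedge>\<^bsub>A\<^esub> cst A q = cst A (p \<curlywedge>\<^bsub>rational_goedel\<^esub> q)"
    "cst A p \<curlyvee>\<^bsub>A\<^esub> cst A q = cst A (p \<curlyvee>\<^bsub>rational_goedel\<^esub> q)"
    "cst A p \<leadsto>\<^bsub>A\<^esub> cst A q = cst A (p \<leadsto>\<^bsub>rational_goedel\<^esub> q)"
    "cst A unit_rat_0 = \<zero>\<^bsub>A\<^esub>" "cst A unit_rat_1 = \<one>\<^bsub>A\<^esub>"
    using cst_hom[OF assms] by (simp_all add: ralg_hom_def rational_goedel_simps(1-3))
qed

definition tops :: "'a ralg \<Rightarrow> unit_rat set" where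
  "tops A = {q. cst A q = \<one>\<^bsub>A\<^esub>}"

text \<open>If constants p < q have the same value, then c_q -> c_p, which is c_p, equals c_p ->
  c_p, which is 1. Hence the kernel of \<open>cst A\<close> has at most one nontrivial class, and
  \<open>tops A\<close> determines it.\<close>

lemma cst_eq_iff:
  assumes A: "A \<in> RGA"
  shows "cst A p = cst A q \<longleftrightarrow> p = q \<or> (p \<in> tops A \<and> q \<in> tops A)"
proof -
  have *: "cst A p = \<one>\<^bsub>A\<^esub>"
    if eq: "cst A p = cst A q" and lt: "real_of_unit_rat p < real_of_unit_rat q" for p q
  proof -
    have "cst A q \<leadsto>\<^bsub>A\<^esub> cst A p = cst A p" "cst A p \<leadsto>\<^bsub>A\<^esub> cst A p = \<one>\<^bsub>A\<^esub>"
      using lt cst_ops(6)[OF A] by (simp_all add: cst_ops[OF A] rational_goedel_def)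
    then show ?thesis using eq by simp
  qed
  have "p = q \<or> (p \<in> tops A \<and> q \<in> tops A)" if eq: "cst A p = cst A q"
    using *[of p q] *[of q p] eq real_of_unit_rat_inject[of p q]
    by (cases "real_of_unit_rat p" "real_of_unit_rat q" rule: linorder_cases) (auto simp: tops_def)
  then show ?thesis by (auto simp: tops_def)
qed

lemma nontrivial_iff:
  assumes A: "A \<in> RGA"
  shows "nontrivial A \<longleftrightarrow> \<zero>\<^bsub>A\<^esub> \<noteq> \<one>\<^bsub>A\<^esub>"
proof
  interpret bl_algebra A using A by (simp add: RGA_def goedel_algebra_def)
  assume "nontrivial A"
  then obtain a b where ab: "a \<in> carrier A" "b \<in> carrier A" "a \<noteq> b"
    by (auto simp: nontrivial_def)
  show "\<zero>\<^bsub>A\<^esub> \<noteq> \<one>\<^bsub>A\<^esub>"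
  proof
    assume "\<zero>\<^bsub>A\<^esub> = \<one>\<^bsub>A\<^esub>"
    then have "x = \<one>\<^bsub>A\<^esub>" if "x \<in> carrier A" for x
      using zero_least[OF that] one_greatest[OF that] meet_comm[OF that one_closed] by simp
    then show False using ab by metis
  qed
next
  show "\<zero>\<^bsub>A\<^esub> \<noteq> \<one>\<^bsub>A\<^esub> \<Longrightarrow> nontrivial A"
    using A by (auto simp: nontrivial_def RGA_def ralg_closed_def)
qed

lemma carrier_zero_generated:
  assumes A: "A \<in> RGA"
  shows "carrier (zero_generated A) = range (cst A)"
proof -
  have cl: "ralg_closed A" using A by (simp add: RGA_def)
  have "ralg_closed (A\<lparr>carrier := range (cst A)\<rparr>)"
    using cst_ops(5,6)[OF A, symmetric] by (simp add: ralg_closed_def cst_ops(1-4)[OF A])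
  moreover have "range (cst A) \<subseteq> carrier A" using cl by (auto simp: ralg_closed_def)
  moreover have "range (cst A) \<subseteq> S" if "ralg_closed (A\<lparr>carrier := S\<rparr>)" for S
    using that by (auto simp: ralg_closed_def)
  ultimately show ?thesis by (auto simp: zero_generated_def)
qed

text \<open>Homomorphisms can only match constants of the same name, and which names coincide is the
  kernel of \<open>cst\<close>, determined by \<open>tops\<close>.\<close>

lemma isomorphic_zero_generated_iff:
  assumes A: "A \<in> RGA" and B: "B \<in> RGA"
  shows "isomorphic (zero_generated A) (zero_generated B) \<longleftrightarrow> tops A = tops B"
proof
  assume "isomorphic (zero_generated A) (zero_generated B)"
  then obtain h where hom: "ralg_hom (zero_generated A) (zero_generated B) h"
    and bij: "bij_betw h (carrier (zero_generated A)) (carrier (zero_generated B))"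
    by (auto simp: isomorphic_def)
  have h: "h (cst A q) = cst B q" for q
    using hom by (simp add: ralg_hom_def zero_generated_def)
  have "cst A q = cst A unit_rat_1 \<longleftrightarrow> cst B q = cst B unit_rat_1" for q
    using bij unfolding bij_betw_def carrier_zero_generated[OF A] h[symmetric]
    by (metis inj_onD rangeI)
  then show "tops A = tops B" by (simp add: tops_def cst_ops(5,6)[OF A] cst_ops(5,6)[OF B])
next
  assume t: "tops A = tops B"
  \<comment> \<open>Any name of x will do: by \<open>cst_eq_iff\<close> and equality of
    \<open>tops\<close>, all names of x have one value in B.\<close>
  define h where "h x = cst B (SOME q. cst A q = x)" for x
  have h: "h (cst A q) = cst B q" for q
  proof -
    have "cst A (SOME p. cst A p = cst A q) = cst A q" by (rule someI[of _ q]) simp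
    then show ?thesis unfolding h_def cst_eq_iff[OF A] cst_eq_iff[OF B] t .
  qed
  have ops: "h (cst A p \<otimes>\<^bsub>A\<^esub> cst A q) = cst B p \<otimes>\<^bsub>B\<^esub> cst B q"
    "h (cst A p \<curlywedge>\<^bsub>A\<^esub> cst A q) = cst B p \<curlywedge>\<^bsub>B\<^esub> cst B q"
    "h (cst A p \<curlyvee>\<^bsub>A\<^esub> cst A q) = cst B p \<curlyvee>\<^bsub>B\<^esub> cst B q"
    "h (cst A p \<leadsto>\<^bsub>A\<^esub> cst A q) = cst B p \<leadsto>\<^bsub>B\<^esub> cst B q" for p q
    by (simp_all add: cst_ops[OF A] cst_ops[OF B] h)
  have "ralg_hom (zero_generated A) (zero_generated B) h"
    using ops h h[of unit_rat_0] h[of unit_rat_1]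
    unfolding ralg_hom_def carrier_zero_generated[OF A] carrier_zero_generated[OF B]
    by (auto simp: zero_generated_def cst_ops(5,6)[OF A] cst_ops(5,6)[OF B])
  moreover have "bij_betw h (range (cst A)) (range (cst B))"
    unfolding bij_betw_def
  proof
    show "inj_on h (range (cst A))"
      by (auto simp: inj_on_def h cst_eq_iff[OF A] cst_eq_iff[OF B] t)
    show "h ` range (cst A) = range (cst B)" by (simp add: image_image h)
  qed
  ultimately show "isomorphic (zero_generated A) (zero_generated B)"
    by (auto simp: isomorphic_def carrier_zero_generated[OF A] carrier_zero_generated[OF B])
qed

lemma tops_embedding:
  assumes "ralg_closed A" "embedding A B h"
  shows "tops A = tops B"
proof -
  have h: "h (cst A q) = cst B q" "h \<one>\<^bsub>A\<^esub> = \<one>\<^bsub>B\<^esub>" for q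
    using assms(2) by (auto simp: embedding_def ralg_hom_def)
  have "cst A q = \<one>\<^bsub>A\<^esub> \<longleftrightarrow> h (cst A q) = h \<one>\<^bsub>A\<^esub>" for q
    using assms by (auto simp: embedding_def ralg_closed_def dest: inj_onD)
  then show ?thesis by (simp add: tops_def h)
qed

section \<open>Solving equations by constants\<close>

text \<open>One step of Cantor's argument: density and the absence of endpoints leave room for a new
  point. The codomain is all of \<open>rat\<close>; values in the unit interval are secured later by
  anchoring 0 and the largest relevant constant.\<close>

lemma strict_mono_on_insert_rat:
  fixes f :: "real \<Rightarrow> rat"
  assumes S: "finite S" and f: "strict_mono_on S f" and x: "x \<notin> S"
  shows "\<exists>c. strict_mono_on (insert x S) (f(x := c))"
proof -
  let ?L = "f ` {s \<in> S. s < x}" and ?U = "f ` {s \<in> S. x < s}"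
  have fin: "finite ?L" "finite ?U" using S by auto
  have LU: "l < u" if "l \<in> ?L" "u \<in> ?U" for l u
    using that f by (auto simp: strict_mono_on_def)
  obtain c where c: "\<And>l. l \<in> ?L \<Longrightarrow> l < c" "\<And>u. u \<in> ?U \<Longrightarrow> c < u"
  proof (cases "?L = {} \<or> ?U = {}")
    case True
    then show ?thesis
    proof
      assume "?L = {}"
      \<comment> \<open>If \<open>?U\<close> is empty as well, \<open>Min ?U\<close> is unspecified
        and both bounds on the witness are vacuous.\<close>
      have "Min ?U - 1 < u" if "u \<in> ?U" for u
        using Min_le[OF fin(2) that] by linarith
      then show ?thesis using that[of "Min ?U - 1"] \<open>?L = {}\<close> by blast
    next
      assume "?U = {}"
      have "l < Max ?L + 1" if "l \<in> ?L" for l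
        using Max_ge[OF fin(1) that] by linarith
      then show ?thesis using that[of "Max ?L + 1"] \<open>?U = {}\<close> by blast
    qed
  next
    case False
    then have "Max ?L < Min ?U" using LU fin by (simp add: Max_in Min_in)
    then obtain c where "Max ?L < c" "c < Min ?U" using dense by blast
    then have "\<forall>l\<in>?L. l < c" "\<forall>u\<in>?U. c < u"
      using fin False by (simp_all add: Max_less_iff Min_gr_iff)
    then show ?thesis using that[of c] by blast
  qed
  then have "strict_mono_on (insert x S) (f(x := c))"
    using f x by (auto simp: strict_mono_on_def)
  then show ?thesis by blast
qed

lemma strict_mono_on_extend_rat:
  fixes f :: "real \<Rightarrow> rat"
  assumes "finite T" "finite S" "strict_mono_on S f"
  shows "\<exists>g. strict_mono_on (S \<union> T) g \<and> (\<forall>x\<in>S. g x = f x)"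
  using assms(1)
proof induction
  case empty
  then show ?case using assms(3) by auto
next
  case (insert x T)
  then obtain g where g: "strict_mono_on (S \<union> T) g" "\<forall>x\<in>S. g x = f x" by blast
  show ?case
  proof (cases "x \<in> S \<union> T")
    case True
    then show ?thesis using g by (auto simp: insert_absorb)
  next
    case False
    then obtain c where "strict_mono_on (S \<union> insert x T) (g(x := c))"
      using strict_mono_on_insert_rat[OF _ g(1) False] insert.hyps assms(2) by auto
    moreover have "\<forall>a\<in>S. (g(x := c)) a = f a" using g(2) False by auto
    ultimately show ?thesis by blast
  qed
qed

section \<open>Separation in the standard Goedel algebra\<close>

lemma standard_goedel_simps:
  "carrier standard_goedel = {0..1}" "\<zero>\<^bsub>standard_goedel\<^esub> = 0" "\<one>\<^bsub>standard_goedel\<^esub> = 1"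
  "a \<otimes>\<^bsub>standard_goedel\<^esub> b = min a b" "a \<curlywedge>\<^bsub>standard_goedel\<^esub> b = min a b"
  "a \<curlyvee>\<^bsub>standard_goedel\<^esub> b = max a b" "a \<leadsto>\<^bsub>standard_goedel\<^esub> b = (if a \<le> b then 1 else b)"
  by (simp_all add: standard_goedel_def)

text \<open>A semantic deduction theorem. If every valuation in [0,1] left some premise at or below
  t, their meet c would lie below t as well, so \<open>BImp c t\<close> would be identically 1 in
  [0,1] and hence in A; at v this reads 1 -> t = 1. Strictness makes the value of t usable as a
  threshold.\<close>

lemma goedel_separation:
  assumes A: "goedel_algebra A" and v: "range v \<subseteq> carrier A" and fin: "finite P"
    and P: "\<forall>p\<in>P. bl_eval A v p = \<one>\<^bsub>A\<^esub>" and t: "bl_eval A v t \<in> carrier A" "bl_eval A v t \<noteq> \<one>\<^bsub>A\<^esub>"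
  shows "\<exists>w. range w \<subseteq> {0..1} \<and> (\<forall>p\<in>P. bl_eval standard_goedel w t < bl_eval standard_goedel w p)"
proof (rule ccontr)
  assume neg: "\<not> ?thesis"
  interpret bl_algebra A using A by (simp add: goedel_algebra_def)
  obtain ps where ps: "set ps = P" using finite_list[OF fin] by blast
  define c where "c = foldr BMeet ps BOne"
  have "foldr BMeet qs BOne = u \<Longrightarrow> \<forall>p\<in>set qs. bl_eval A v p = \<one>\<^bsub>A\<^esub> \<Longrightarrow> bl_eval A v u = \<one>\<^bsub>A\<^esub>" for qs u
    by (induction qs arbitrary: u) (auto simp: one_greatest)
  then have c1: "bl_eval A v c = \<one>\<^bsub>A\<^esub>" using P ps c_def by blast
  have le: "p \<in> set qs \<Longrightarrow> bl_eval standard_goedel w (foldr BMeet qs BOne) \<le> bl_eval standard_goedel w p"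
    for w qs p
    by (induction qs) (auto simp: standard_goedel_simps min_le_iff_disj)
  have "bl_identity standard_goedel (BImp c t) BOne"
    unfolding bl_identity_def
  proof (intro allI impI)
    fix w :: "nat \<Rightarrow> real" assume w: "range w \<subseteq> carrier standard_goedel"
    then obtain p where "p \<in> P" "bl_eval standard_goedel w p \<le> bl_eval standard_goedel w t"
      using neg by (auto simp: standard_goedel_simps not_less)
    then have "bl_eval standard_goedel w c \<le> bl_eval standard_goedel w t"
      using le[of p ps w] ps by (simp add: c_def)
    then show "bl_eval standard_goedel w (BImp c t) = bl_eval standard_goedel w BOne"
      by (simp add: standard_goedel_simps)
  qed
  then have "bl_identity A (BImp c t) BOne" using A by (simp add: goedel_algebra_def)
  then have "bl_eval A v (BImp c t) = \<one>\<^bsub>A\<^esub>" using v unfolding bl_identity_def by simp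
  then show False using t one_imp c1 by simp
qed

primrec atoms :: "fm \<Rightarrow> fm set" where
  "atoms (Var n) = {Var n}"
| "atoms Zero = {}"
| "atoms One = {}"
| "atoms (Cst q) = {Cst q}"
| "atoms (Meet s t) = atoms s \<union> atoms t"
| "atoms (Join s t) = atoms s \<union> atoms t"
| "atoms (Mult s t) = atoms s \<union> atoms t"
| "atoms (Imp s t) = atoms s \<union> atoms t"

lemma finite_atoms: "finite (atoms \<phi>)"
  by (induction \<phi>) auto

text \<open>The coding of formulas by \<open>to_nat\<close> keeps variables and constants apart, and
  \<open>from_nat\<close> recovers the atom behind each index. Identities of [0,1] thereby apply to
  formulas with constants.\<close>

primrec bl_of_fm :: "fm \<Rightarrow> bl_term" where
  "bl_of_fm (Var n) = BVar (to_nat (Var n))"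
| "bl_of_fm Zero = BZero"
| "bl_of_fm One = BOne"
| "bl_of_fm (Cst q) = BVar (to_nat (Cst q))"
| "bl_of_fm (Meet s t) = BMeet (bl_of_fm s) (bl_of_fm t)"
| "bl_of_fm (Join s t) = BJoin (bl_of_fm s) (bl_of_fm t)"
| "bl_of_fm (Mult s t) = BMult (bl_of_fm s) (bl_of_fm t)"
| "bl_of_fm (Imp s t) = BImp (bl_of_fm s) (bl_of_fm t)"

lemma bl_eval_bl_of_fm: "bl_eval A (eval A v \<circ> from_nat) (bl_of_fm \<phi>) = eval A v \<phi>"
  by (induction \<phi>) auto

text \<open>Apply separation to the formulas with their constants read as variables: the extra premises
  pin down the order of the finitely many constants, and then everything above the value \<open>s\<close> of
  the largest constant \<open>m\<close> with \<open>cst A m \<noteq> 1\<close> may be collapsed to 1.\<close>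

lemma constant_solution_fm:
  assumes A: "A \<in> RGA" and nontriv: "nontrivial A" and fin: "finite \<Gamma>"
    and v: "range v \<subseteq> carrier A" and \<Gamma>: "\<forall>\<gamma>\<in>\<Gamma>. eval A v \<gamma> = \<one>\<^bsub>A\<^esub>"
  shows "\<exists>\<kappa>. \<forall>\<gamma>\<in>\<Gamma>. eval A (cst A \<circ> \<kappa>) \<gamma> = \<one>\<^bsub>A\<^esub>"
proof -
  interpret bl_algebra A using A by (simp add: RGA_def goedel_algebra_def)
  have cl: "ralg_closed A" and G: "goedel_algebra A" using A by (auto simp: RGA_def)
  have clc: "cst A q \<in> carrier A" for q using cl by (simp add: ralg_closed_def)
  let ?r = real_of_unit_rat
  let ?ev = "bl_eval standard_goedel"
  \<comment> \<open>Adding \<open>Cst unit_rat_0\<close> makes \<open>C0\<close> nonempty, as A is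
    nontrivial, and provides 0 as a lower anchor.\<close>
  define At where "At = insert (Cst unit_rat_0) (\<Union>(atoms ` \<Gamma>))"
  have finAt: "finite At" using fin by (simp add: At_def finite_atoms)
  define C where "C = {q. Cst q \<in> At}"
  have finC: "finite C"
    using finAt finite_vimageI[of At Cst] by (simp add: C_def inj_on_def vimage_def)
  define C0 where "C0 = C - tops A"
  define y where "y q = BVar (to_nat (Cst q))" for q
  have zero: "unit_rat_0 \<in> C0"
    using A nontriv by (simp add: C0_def C_def At_def tops_def cst_ops nontrivial_iff)
  have finC0: "finite C0" using finC by (simp add: C0_def)
  define m where "m = inv_into C0 ?r (Max (?r ` C0))"
  have "Max (?r ` C0) \<in> ?r ` C0" using finC0 zero by (intro Max_in) auto
  then have m: "m \<in> C0" "?r m = Max (?r ` C0)"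
    unfolding m_def by (simp_all add: inv_into_into f_inv_into_f)
  have m_max: "?r q \<le> ?r m" if "q \<in> C0" for q using m(2) that finC0 by simp
  \<comment> \<open>Each premise is 1 in A, so it may be required to exceed s, the value of m, in
    [0,1]. The nested implication expresses strictness: when the value of p is at most s, (q -> p)
    -> p exceeds s only if p lies strictly below q. The last family forces that bound, and the
    premise with \<open>BZero\<close> forces the constant 0 to have value 0.\<close>
  define P where "P = bl_of_fm ` \<Gamma> \<union> y ` (C \<inter> tops A) \<union> {BImp (y unit_rat_0) BZero} \<union>
    (\<lambda>(p, q). BImp (BImp (y q) (y p)) (y p)) ` {(p, q) \<in> C0 \<times> C0. ?r p < ?r q} \<union>
    (\<lambda>q. BImp (y q) (y m)) ` C0"
  let ?v = "eval A v \<circ> from_nat"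
  have yv: "bl_eval A ?v (y q) = cst A q" for q by (simp add: y_def)
  have self: "a \<leadsto>\<^bsub>A\<^esub> a = \<one>\<^bsub>A\<^esub>" if "a \<in> range (cst A)" for a
    using that by (auto simp: cst_ops(4,6)[OF A] rational_goedel_simps)
  have "\<exists>w. range w \<subseteq> {0..1} \<and> (\<forall>p\<in>P. ?ev w (y m) < ?ev w p)"
  proof (rule goedel_separation[OF G])
    show "range ?v \<subseteq> carrier A" using eval_closed[OF cl v] by auto
    have "finite {(p, q) \<in> C0 \<times> C0. ?r p < ?r q}"
      by (rule finite_subset[of _ "C0 \<times> C0"]) (use finC0 in auto)
    then show "finite P" using fin finC finC0 by (simp add: P_def)
    show "\<forall>p\<in>P. bl_eval A ?v p = \<one>\<^bsub>A\<^esub>"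
      using \<Gamma> m_max by (auto simp: P_def bl_eval_bl_of_fm yv tops_def self cst_ops(4,6)[OF A]
        cst_ops(5)[OF A, symmetric] rational_goedel_simps)
    show "bl_eval A ?v (y m) \<in> carrier A" "bl_eval A ?v (y m) \<noteq> \<one>\<^bsub>A\<^esub>"
      using m(1) by (auto simp: yv clc C0_def tops_def)
  qed
  then obtain w where w: "range w \<subseteq> {0..1}" and wP: "\<forall>p\<in>P. ?ev w (y m) < ?ev w p" by blast
  have inP: "\<gamma> \<in> \<Gamma> \<Longrightarrow> bl_of_fm \<gamma> \<in> P" "q \<in> C \<Longrightarrow> q \<in> tops A \<Longrightarrow> y q \<in> P"
    "BImp (y unit_rat_0) BZero \<in> P" "p \<in> C0 \<Longrightarrow> BImp (y p) (y m) \<in> P"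
    "p \<in> C0 \<Longrightarrow> q \<in> C0 \<Longrightarrow> ?r p < ?r q \<Longrightarrow> BImp (BImp (y q) (y p)) (y p) \<in> P" for p q \<gamma>
    unfolding P_def by (blast, blast, blast, blast, force)
  define z where "z a = w (to_nat a)" for a :: fm
  define s where "s = z (Cst m)"
  have z01: "0 \<le> z a" "z a \<le> 1" for a using w by (auto simp: z_def image_subset_iff)
  have evy: "?ev w (y q) = z (Cst q)" for q by (simp add: y_def z_def)
  have top: "s < z (Cst q)" if "q \<in> C" "q \<in> tops A" for q
    using bspec[OF wP inP(2)[OF that]] by (simp add: evy s_def)
  have le_s: "z (Cst q) \<le> s" if "q \<in> C0" for q
  proof -
    have "s < ?ev w (BImp (y q) (y m))"
      using bspec[OF wP inP(4)[OF that]] by (simp only: evy s_def)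
    then show ?thesis by (auto simp: standard_goedel_simps evy s_def split: if_splits)
  qed
  have mono: "z (Cst p) < z (Cst q)" if "p \<in> C0" "q \<in> C0" "?r p < ?r q" for p q
  proof (rule ccontr)
    assume neg: "\<not> ?thesis"
    have "s < ?ev w (BImp (BImp (y q) (y p)) (y p))"
      using bspec[OF wP inP(5)[OF that]] by (simp only: evy s_def)
    then show False
      using neg le_s[OF that(1)] z01[of "Cst p"] by (auto simp: standard_goedel_simps evy split: if_splits)
  qed
  have z0: "z (Cst unit_rat_0) = 0"
  proof -
    have "s < ?ev w (BImp (y unit_rat_0) BZero)" using bspec[OF wP inP(3)] by (simp only: evy s_def)
    then show ?thesis
      using z01[of "Cst unit_rat_0"] z01[of "Cst m"] by (auto simp: standard_goedel_simps evy s_def split: if_splits)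
  qed
  have s1: "s < 1"
  proof -
    have "s < ?ev w (BImp (y unit_rat_0) BZero)" using bspec[OF wP inP(3)] by (simp only: evy s_def)
    also have "\<dots> \<le> 1" by (simp add: standard_goedel_simps)
    finally show ?thesis .
  qed
  have s0: "0 \<le> s" using z01 by (simp add: s_def)
  define S where "S = (\<lambda>q. z (Cst q)) ` C0"
  define V where "V = {0, 1} \<union> z ` At"
  have finV: "finite V" using finAt by (simp add: V_def)
  have inj: "inj_on (\<lambda>q. z (Cst q)) C0"
  proof (rule inj_onI)
    fix p q assume pq: "p \<in> C0" "q \<in> C0" "z (Cst p) = z (Cst q)"
    show "p = q"
      using mono[OF pq(1,2)] mono[OF pq(2,1)] pq(3) real_of_unit_rat_inject
      by (metis less_irrefl linorder_neqE)
  qed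
  \<comment> \<open>Constants outside \<open>tops A\<close> must keep their names, so the order
    embedding starts as the inverse of the valuation on \<open>C0\<close>.\<close>
  define f where "f x = Rep_unit_rat (inv_into C0 (\<lambda>q. z (Cst q)) x)" for x
  have f: "f (z (Cst q)) = Rep_unit_rat q" if "q \<in> C0" for q
    using that by (simp add: f_def inv_into_f_f[OF inj])
  have "strict_mono_on S f"
  proof (rule strict_mono_onI)
    fix a b assume "a \<in> S" "b \<in> S" "a < b"
    then obtain p q where pq: "p \<in> C0" "q \<in> C0" "a = z (Cst p)" "b = z (Cst q)"
      by (auto simp: S_def)
    have "?r p < ?r q"
      using mono[OF pq(2,1)] pq(3,4) \<open>a < b\<close> real_of_unit_rat_inject
      by (metis less_asym less_irrefl linorder_neqE)
    then show "f a < f b" by (simp add: pq f real_of_unit_rat_def of_rat_less)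
  qed
  then obtain \<rho> where \<rho>: "strict_mono_on (S \<union> V) \<rho>" "\<forall>x\<in>S. \<rho> x = f x"
    using strict_mono_on_extend_rat[OF finV, of S f] finC0 by (auto simp: S_def)
  have \<rho>q: "\<rho> (z (Cst q)) = Rep_unit_rat q" if "q \<in> C0" for q
    using \<rho>(2) f that by (simp add: S_def)
  \<comment> \<open>Above s the values of \<rho> may leave the unit interval; they are discarded in
    favour of 1.\<close>
  define \<kappa> where "\<kappa> x = (if s < x then unit_rat_1 else Abs_unit_rat (\<rho> x))" for x
  have m1: "?r m < 1"
    using m(1) real_of_unit_rat_bounds(2)[of m] real_of_unit_rat_inject[of m unit_rat_1]
    by (auto simp: C0_def tops_def cst_ops[OF A] real_of_unit_rat_1 less_le)
  \<comment> \<open>Monotonicity traps \<rho> x between the images of the anchors 0 and s, which are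
    0 and m.\<close>
  have \<rho>_bounds: "0 \<le> \<rho> x" "\<rho> x \<le> Rep_unit_rat m" if "x \<in> V" "x \<le> s" for x
  proof -
    have x: "0 \<le> x" using that z01 by (auto simp: V_def)
    have "0 \<in> S" "s \<in> S" using zero m(1) z0 unfolding S_def s_def by force+
    then have "\<rho> 0 \<le> \<rho> x" "\<rho> x \<le> \<rho> s"
      using x that strict_mono_on_leD[OF \<rho>(1)] by auto
    moreover have "\<rho> 0 = 0" using \<rho>q[OF zero] z0 by (simp add: unit_rat_0_def Abs_unit_rat_inverse)
    moreover have "\<rho> s = Rep_unit_rat m" using \<rho>q[OF m(1)] by (simp add: s_def)
    ultimately show "0 \<le> \<rho> x" "\<rho> x \<le> Rep_unit_rat m" by simp_all
  qed
  have r\<kappa>: "?r (\<kappa> x) = of_rat (\<rho> x)" if "x \<in> V" "x \<le> s" for x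
    using \<rho>_bounds[OF that] Rep_unit_rat[of m] that
    by (simp add: \<kappa>_def real_of_unit_rat_def Abs_unit_rat_inverse)
  have \<kappa>1: "\<kappa> x = unit_rat_1" if "s < x" for x using that by (simp add: \<kappa>_def)
  have less: "?r (\<kappa> x) < ?r (\<kappa> x')" if "x \<in> V" "x' \<in> V" "x < x'" "x \<le> s" for x x'
  proof (cases "x' \<le> s")
    case True
    then show ?thesis
      using that strict_mono_onD[OF \<rho>(1)] by (simp add: r\<kappa> of_rat_less)
  next
    case False
    have "?r (\<kappa> x) \<le> ?r m"
      using \<rho>_bounds(2)[OF that(1,4)] r\<kappa>[OF that(1,4)] by (simp add: real_of_unit_rat_def of_rat_less_eq)
    then show ?thesis using False m1 by (simp add: \<kappa>1 real_of_unit_rat_1)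
  qed
  have le: "?r (\<kappa> x) \<le> ?r (\<kappa> x')" if "x \<in> V" "x' \<in> V" "x \<le> x'" for x x'
    using less[of x x'] that \<kappa>1[of x] \<kappa>1[of x'] by (cases "x = x'"; cases "x \<le> s") auto
  have V01: "0 \<in> V" "1 \<in> V" by (auto simp: V_def)
  have \<kappa>0: "\<kappa> 0 = unit_rat_0"
    using \<rho>q[OF zero] z0 s0 by (simp add: \<kappa>_def Rep_unit_rat_inverse)
  have eq: "?r p \<le> ?r q \<Longrightarrow> ?r q \<le> ?r p \<Longrightarrow> p = q" for p q
    using real_of_unit_rat_inject by (metis order_antisym)
  \<comment> \<open>Implication is the delicate operation. For x' < x with x' at most s, strictness
    (\<open>less\<close>) makes the implication return \<kappa> x'; if x' lies above s, both sides
    are 1.\<close>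
  have \<kappa>hom: "\<kappa> (min x x') = \<kappa> x \<otimes>\<^bsub>rational_goedel\<^esub> \<kappa> x'"
    "\<kappa> (min x x') = \<kappa> x \<curlywedge>\<^bsub>rational_goedel\<^esub> \<kappa> x'"
    "\<kappa> (max x x') = \<kappa> x \<curlyvee>\<^bsub>rational_goedel\<^esub> \<kappa> x'"
    "\<kappa> (if x \<le> x' then 1 else x') = \<kappa> x \<leadsto>\<^bsub>rational_goedel\<^esub> \<kappa> x'"
    if x: "x \<in> V" "x' \<in> V" for x x'
  proof -
    have *: "x \<le> x' \<Longrightarrow> ?r (\<kappa> x) \<le> ?r (\<kappa> x')" "\<not> x \<le> x' \<Longrightarrow> ?r (\<kappa> x') \<le> ?r (\<kappa> x)"
      using le[OF x] le[OF x(2,1)] by auto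
    show "\<kappa> (min x x') = \<kappa> x \<otimes>\<^bsub>rational_goedel\<^esub> \<kappa> x'"
      "\<kappa> (min x x') = \<kappa> x \<curlywedge>\<^bsub>rational_goedel\<^esub> \<kappa> x'"
      "\<kappa> (max x x') = \<kappa> x \<curlyvee>\<^bsub>rational_goedel\<^esub> \<kappa> x'"
      by (cases "x \<le> x'"; use * in \<open>simp add: rational_goedel_simps eq\<close>)+
    show "\<kappa> (if x \<le> x' then 1 else x') = \<kappa> x \<leadsto>\<^bsub>rational_goedel\<^esub> \<kappa> x'"
    proof (cases "x \<le> x'")
      case True
      then show ?thesis using * \<kappa>1[OF s1] by (simp add: rational_goedel_simps)
    next
      case False
      then show ?thesis
        using less[OF x(2,1)] \<kappa>1[of x'] by (cases "x' \<le> s") (auto simp: rational_goedel_simps)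
    qed
  qed
  have Vcl: "min x x' \<in> V" "max x x' \<in> V" "(if x \<le> x' then 1 else x') \<in> V"
    if "x \<in> V" "x' \<in> V" for x x'
    using that V01 by (simp_all add: min_def max_def)
  \<comment> \<open>Goedel operations return an argument or 1, so values stay in the finite set V,
    on which \<kappa> respects the operations. A constant is recovered only up to its value in A,
    hence the comparison under \<open>cst A\<close>.\<close>
  have main: "?ev w (bl_of_fm \<phi>) \<in> V \<and>
      eval A (cst A \<circ> (\<lambda>n. \<kappa> (z (Var n)))) \<phi> = cst A (\<kappa> (?ev w (bl_of_fm \<phi>)))"
    if "atoms \<phi> \<subseteq> At" for \<phi>
    using that
  proof (induction \<phi>)
    case (Cst q)
    then have q: "q \<in> C" by (simp add: C_def)
    have "cst A q = cst A (\<kappa> (z (Cst q)))"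
    proof (cases "q \<in> tops A")
      case True
      then show ?thesis using top[OF q] by (simp add: \<kappa>1 cst_ops[OF A] tops_def)
    next
      case False
      then have "q \<in> C0" using q by (simp add: C0_def)
      then show ?thesis using le_s[of q] \<rho>q[of q] by (simp add: \<kappa>_def Rep_unit_rat_inverse)
    qed
    then show ?case using Cst by (simp add: z_def[symmetric] V_def)
  next
    case (Var n)
    then show ?case by (simp add: z_def[symmetric] V_def)
  next
    case (Meet \<phi> \<psi>)
    then show ?case by (simp add: standard_goedel_simps(5) cst_ops[OF A] \<kappa>hom(2) Vcl(1))
  next
    case (Join \<phi> \<psi>)
    then show ?case by (simp add: standard_goedel_simps(6) cst_ops[OF A] \<kappa>hom(3) Vcl(2))
  next
    case (Mult \<phi> \<psi>)
    then show ?case by (simp add: standard_goedel_simps(4) cst_ops[OF A] \<kappa>hom(1) Vcl(1))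
  next
    case (Imp \<phi> \<psi>)
    then show ?case
      by (simp only: atoms.simps eval.simps bl_of_fm.simps bl_eval.simps standard_goedel_simps(7)
          cst_ops(4)[OF A] \<kappa>hom(4) Vcl(3) Un_subset_iff simp_thms)
  qed (use V01 \<kappa>0 \<kappa>1[OF s1] in \<open>simp_all add: standard_goedel_simps cst_ops[OF A]\<close>)
  have "eval A (cst A \<circ> (\<lambda>n. \<kappa> (z (Var n)))) \<gamma> = \<one>\<^bsub>A\<^esub>" if "\<gamma> \<in> \<Gamma>" for \<gamma>
  proof -
    have "s < ?ev w (bl_of_fm \<gamma>)" using bspec[OF wP inP(1)[OF that]] by (simp only: evy s_def)
    moreover have "atoms \<gamma> \<subseteq> At" using that by (auto simp: At_def)
    ultimately show ?thesis using main[of \<gamma>] by (simp add: \<kappa>1 cst_ops[OF A])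
  qed
  then show ?thesis by blast
qed

section \<open>Algebraization\<close>

primrec fm_of_bl :: "bl_term \<Rightarrow> fm" where
  "fm_of_bl (BVar n) = Var n"
| "fm_of_bl BZero = Zero"
| "fm_of_bl BOne = One"
| "fm_of_bl (BMeet s t) = Meet (fm_of_bl s) (fm_of_bl t)"
| "fm_of_bl (BJoin s t) = Join (fm_of_bl s) (fm_of_bl t)"
| "fm_of_bl (BMult s t) = Mult (fm_of_bl s) (fm_of_bl t)"
| "fm_of_bl (BImp s t) = Imp (fm_of_bl s) (fm_of_bl t)"

lemma eval_fm_of_bl: "eval A v (fm_of_bl t) = bl_eval A v t"
  by (induction t) auto

text \<open>Apart from closure and residuation, the axioms of BL-algebras are equations valid in
  [0,1]. Residuation is an equivalence between two equations and has to be supplied.\<close>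

lemma goedel_quasi_identities:
  assumes cl: "ralg_closed A"
    and id: "\<And>s t. bl_identity standard_goedel s t \<Longrightarrow> bl_identity A s t"
    and res: "\<And>a b c. \<lbrakk>a \<in> carrier A; b \<in> carrier A; c \<in> carrier A\<rbrakk>
      \<Longrightarrow> bl_le A (a \<otimes>\<^bsub>A\<^esub> b) c \<longleftrightarrow> bl_le A a (b \<leadsto>\<^bsub>A\<^esub> c)"
  shows "goedel_algebra A"
proof -
  have id3: "bl_eval A (\<lambda>n. if n = 0 then a else if n = 1 then b else c) s =
      bl_eval A (\<lambda>n. if n = 0 then a else if n = 1 then b else c) t"
    if "bl_identity standard_goedel s t" "a \<in> carrier A" "b \<in> carrier A" "c \<in> carrier A" for s t a b c
    by (rule id[OF that(1), unfolded bl_identity_def, rule_format]) (use that in auto)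
  interpret S: bl_algebra standard_goedel by (rule bl_algebra_standard_goedel)
  note std = bl_identity_def image_subset_iff
  let ?x = "BVar 0" and ?y = "BVar 1" and ?z = "BVar 2"
  have "bl_algebra A"
  proof unfold_locales
    fix a b assume ab: "a \<in> carrier A" "b \<in> carrier A"
    show "a \<otimes>\<^bsub>A\<^esub> b \<in> carrier A" "a \<curlywedge>\<^bsub>A\<^esub> b \<in> carrier A" "a \<curlyvee>\<^bsub>A\<^esub> b \<in> carrier A"
      "a \<leadsto>\<^bsub>A\<^esub> b \<in> carrier A" using cl ab by (auto simp: ralg_closed_def)
    show "a \<otimes>\<^bsub>A\<^esub> b = b \<otimes>\<^bsub>A\<^esub> a"
      using id3[of "BMult ?x ?y" "BMult ?y ?x", OF _ ab ab(1)] by (simp add: std S.m_comm)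
    show "a \<curlywedge>\<^bsub>A\<^esub> b = b \<curlywedge>\<^bsub>A\<^esub> a"
      using id3[of "BMeet ?x ?y" "BMeet ?y ?x", OF _ ab ab(1)] by (simp add: std S.meet_comm)
    show "a \<curlyvee>\<^bsub>A\<^esub> b = b \<curlyvee>\<^bsub>A\<^esub> a"
      using id3[of "BJoin ?x ?y" "BJoin ?y ?x", OF _ ab ab(1)] by (simp add: std S.join_comm)
    show "a \<curlywedge>\<^bsub>A\<^esub> (a \<curlyvee>\<^bsub>A\<^esub> b) = a"
      using id3[of "BMeet ?x (BJoin ?x ?y)" "?x", OF _ ab ab(1)] by (simp add: std S.meet_absorb)
    show "a \<curlyvee>\<^bsub>A\<^esub> (a \<curlywedge>\<^bsub>A\<^esub> b) = a"
      using id3[of "BJoin ?x (BMeet ?x ?y)" "?x", OF _ ab ab(1)] by (simp add: std S.join_absorb)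
    show "(a \<leadsto>\<^bsub>A\<^esub> b) \<curlyvee>\<^bsub>A\<^esub> (b \<leadsto>\<^bsub>A\<^esub> a) = \<one>\<^bsub>A\<^esub>"
      using id3[of "BJoin (BImp ?x ?y) (BImp ?y ?x)" BOne, OF _ ab ab(1)] by (simp add: std S.prelinearity)
    show "a \<curlywedge>\<^bsub>A\<^esub> b = a \<otimes>\<^bsub>A\<^esub> (a \<leadsto>\<^bsub>A\<^esub> b)"
      using id3[of "BMeet ?x ?y" "BMult ?x (BImp ?x ?y)", OF _ ab ab(1)] by (simp add: std S.divisibility)
    show "\<one>\<^bsub>A\<^esub> \<otimes>\<^bsub>A\<^esub> a = a"
      using id3[of "BMult BOne ?x" "?x", OF _ ab ab(1)] by (simp add: std S.l_one)
    show "a \<otimes>\<^bsub>A\<^esub> \<one>\<^bsub>A\<^esub> = a"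
      using id3[of "BMult ?x BOne" "?x", OF _ ab ab(1)] by (simp add: std S.r_one)
    show "bl_le A \<zero>\<^bsub>A\<^esub> a"
      using id3[of "BMeet BZero ?x" BZero, OF _ ab ab(1)] by (simp add: std S.zero_least)
    show "bl_le A a \<one>\<^bsub>A\<^esub>"
      using id3[of "BMeet ?x BOne" ?x, OF _ ab ab(1)] by (simp add: std S.one_greatest)
    fix c assume c: "c \<in> carrier A"
    show "a \<otimes>\<^bsub>A\<^esub> b \<otimes>\<^bsub>A\<^esub> c = a \<otimes>\<^bsub>A\<^esub> (b \<otimes>\<^bsub>A\<^esub> c)"
      using id3[of "BMult (BMult ?x ?y) ?z" "BMult ?x (BMult ?y ?z)", OF _ ab c] by (simp add: std S.m_assoc)
    show "a \<curlywedge>\<^bsub>A\<^esub> b \<curlywedge>\<^bsub>A\<^esub> c = a \<curlywedge>\<^bsub>A\<^esub> (b \<curlywedge>\<^bsub>A\<^esub> c)"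
      using id3[of "BMeet (BMeet ?x ?y) ?z" "BMeet ?x (BMeet ?y ?z)", OF _ ab c] by (simp add: std S.meet_assoc)
    show "a \<curlyvee>\<^bsub>A\<^esub> b \<curlyvee>\<^bsub>A\<^esub> c = a \<curlyvee>\<^bsub>A\<^esub> (b \<curlyvee>\<^bsub>A\<^esub> c)"
      using id3[of "BJoin (BJoin ?x ?y) ?z" "BJoin ?x (BJoin ?y ?z)", OF _ ab c] by (simp add: std S.join_assoc)
    show "bl_le A (a \<otimes>\<^bsub>A\<^esub> b) c \<longleftrightarrow> bl_le A a (b \<leadsto>\<^bsub>A\<^esub> c)" by (rule res[OF ab c])
  qed (use cl in \<open>auto simp: ralg_closed_def\<close>)
  then show ?thesis using id by (simp add: goedel_algebra_def)
qed

text \<open>Identities, the two halves of residuation and ground equations for the constants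
  axiomatize \<open>RGA\<close> over any type. As \<open>RG\<close> is defined by algebras on
  \<open>nat\<close>, this is the bridge from its rules to algebras on \<open>'a\<close>.\<close>

lemma RGA_if_quasi_equations:
  fixes A :: "'a ralg"
  assumes cl: "ralg_closed A"
    and Q: "\<And>E e. finite E \<Longrightarrow> eq_conseq (RGA :: nat ralg set) E e \<Longrightarrow> eq_conseq {A} E e"
  shows "A \<in> RGA"
proof -
  have ground: "eval A v s = eval A v t"
    if "\<And>(B :: nat ralg) w. B \<in> RGA \<Longrightarrow> range w \<subseteq> carrier B \<Longrightarrow> eval B w s = eval B w t"
      "range v \<subseteq> carrier A" for s t v
    using Q[of "{}" "(s, t)"] that by (simp add: eq_conseq_def sat_eq_def)
  have id: "bl_identity A s t" if "bl_identity standard_goedel s t" for s t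
    unfolding bl_identity_def
  proof (intro allI impI)
    fix v :: "nat \<Rightarrow> 'a" assume v: "range v \<subseteq> carrier A"
    have "eval A v (fm_of_bl s) = eval A v (fm_of_bl t)"
      by (rule ground[OF _ v]) (use that in \<open>auto simp: RGA_def goedel_algebra_def eval_fm_of_bl bl_identity_def\<close>)
    then show "bl_eval A v s = bl_eval A v t" by (simp add: eval_fm_of_bl)
  qed
  have res: "bl_le A (a \<otimes>\<^bsub>A\<^esub> b) c \<longleftrightarrow> bl_le A a (b \<leadsto>\<^bsub>A\<^esub> c)"
    if "a \<in> carrier A" "b \<in> carrier A" "c \<in> carrier A" for a b c
  proof -
    let ?v = "\<lambda>n. if n = 0 then a else if n = 1 then b else c"
    let ?e1 = "(Meet (Mult (Var 0) (Var 1)) (Var 2), Mult (Var 0) (Var 1))"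
    let ?e2 = "(Meet (Var 0) (Imp (Var 1) (Var 2)), Var 0)"
    have "eq_conseq (RGA :: nat ralg set) {?e1} ?e2" "eq_conseq (RGA :: nat ralg set) {?e2} ?e1"
      by (auto simp: eq_conseq_def sat_eq_def RGA_def goedel_algebra_def bl_algebra.residuation
          image_subset_iff)
    then have "eq_conseq {A} {?e1} ?e2" "eq_conseq {A} {?e2} ?e1" using Q by auto
    moreover have "range ?v \<subseteq> carrier A" using that by auto
    ultimately have "sat_eq A ?v ?e1 \<longleftrightarrow> sat_eq A ?v ?e2" unfolding eq_conseq_def by blast
    then show ?thesis by (simp add: sat_eq_def)
  qed
  have v: "range (\<lambda>_. \<one>\<^bsub>A\<^esub>) \<subseteq> carrier A" using cl by (auto simp: ralg_closed_def)
  have "cst A p \<otimes>\<^bsub>A\<^esub> cst A q = cst A r"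
    if "real_of_unit_rat r = real_of_unit_rat p \<otimes>\<^bsub>standard_goedel\<^esub> real_of_unit_rat q" for p q r
    using ground[of "Mult (Cst p) (Cst q)" "Cst r", OF _ v] that by (auto simp: RGA_def)
  moreover have "cst A p \<leadsto>\<^bsub>A\<^esub> cst A q = cst A r"
    if "real_of_unit_rat r = real_of_unit_rat p \<leadsto>\<^bsub>standard_goedel\<^esub> real_of_unit_rat q" for p q r
    using ground[of "Imp (Cst p) (Cst q)" "Cst r", OF _ v] that by (auto simp: RGA_def)
  moreover have "cst A q = \<zero>\<^bsub>A\<^esub>" if "real_of_unit_rat q = 0" for q
    using ground[of "Cst q" Zero, OF _ v] that by (auto simp: RGA_def)
  moreover have "cst A q = \<one>\<^bsub>A\<^esub>" if "real_of_unit_rat q = 1" for q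
    using ground[of "Cst q" One, OF _ v] that by (auto simp: RGA_def)
  ultimately show ?thesis
    using goedel_quasi_identities[OF cl id res] cl by (simp add: RGA_def)
qed

text \<open>The target type is prescribed, so a class is represented by the image under j of a
  chosen member.\<close>

lemma ralg_quotient:
  fixes T :: "'b ralg" and j :: "'b \<Rightarrow> 'a"
  assumes T: "carrier T = UNIV" and R: "equivp R" and j: "inj j"
    and cong: "\<And>f s s' t t'. f \<in> {monoid.mult T, bmeet T, bjoin T, bimp T} \<Longrightarrow> R s s' \<Longrightarrow> R t t'
      \<Longrightarrow> R (f s t) (f s' t')"
  shows "\<exists>(C :: 'a ralg) k. ralg_closed C \<and> ralg_hom T C k \<and> carrier C = range k \<and>
    (\<forall>s t. k s = k t \<longleftrightarrow> R s t)"
proof -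
  define k where "k s = j (SOME t. R s t)" for s
  have "R s (SOME t. R s t)" for s by (rule someI) (rule equivp_reflp[OF R])
  \<comment> \<open>For related s and t the predicates \<open>R s\<close> and \<open>R t\<close> are
    equal, so \<open>SOME\<close> picks the same member.\<close>
  then have k: "k s = k t \<longleftrightarrow> R s t" for s t
    using R j unfolding k_def inj_eq[OF j] equivp_def by (metis (mono_tags))
  define g where "g = inv_into UNIV k"
  have g: "R (g (k s)) s" for s by (simp add: g_def f_inv_into_f flip: k)
  define C where "C = \<lparr>carrier = range k, monoid.mult = (\<lambda>x y. k (g x \<otimes>\<^bsub>T\<^esub> g y)), one = k \<one>\<^bsub>T\<^esub>,
       bmeet = (\<lambda>x y. k (g x \<curlywedge>\<^bsub>T\<^esub> g y)), bjoin = (\<lambda>x y. k (g x \<curlyvee>\<^bsub>T\<^esub> g y)),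
       bimp = (\<lambda>x y. k (g x \<leadsto>\<^bsub>T\<^esub> g y)), bzero = k \<zero>\<^bsub>T\<^esub>, cst = (\<lambda>q. k (cst T q))\<rparr>"
  have "ralg_closed C" by (auto simp: ralg_closed_def C_def)
  moreover have "k (f (g (k s)) (g (k t))) = k (f s t)"
    if "f \<in> {monoid.mult T, bmeet T, bjoin T, bimp T}" for f s t
    using cong[OF that g g] k by blast
  then have "ralg_hom T C k" by (simp add: ralg_hom_def C_def T)
  moreover have "carrier C = range k" by (simp add: C_def)
  ultimately show ?thesis using k by blast
qed

section \<open>The Lindenbaum-Tarski algebra and completeness\<close>

lemma eval_subst: "eval A v (subst \<sigma> \<phi>) = eval A (\<lambda>n. eval A v (\<sigma> n)) \<phi>"
  by (induction \<phi>) auto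

text \<open>The absolutely free algebra. Its valuations are substitutions, so substitution
  invariance of a logic turns into validity of its rules in a quotient.\<close>

definition fm_algebra :: "fm ralg" where
  "fm_algebra = \<lparr>carrier = UNIV, monoid.mult = Mult, one = One, bmeet = Meet, bjoin = Join,
     bimp = Imp, bzero = Zero, cst = Cst\<rparr>"

lemma carrier_fm_algebra: "carrier fm_algebra = UNIV"
  by (simp add: fm_algebra_def)

lemma fm_algebra_closed: "ralg_closed fm_algebra"
  by (simp add: ralg_closed_def fm_algebra_def)

lemma eval_fm_algebra: "eval fm_algebra \<sigma> \<phi> = subst \<sigma> \<phi>"
  by (induction \<phi>) (auto simp: fm_algebra_def)

definition models :: "(fm set \<Rightarrow> fm \<Rightarrow> bool) \<Rightarrow> 'a ralg set" where
  "models L = {A \<in> RGA. \<forall>\<Gamma> \<phi>. finite \<Gamma> \<longrightarrow> L \<Gamma> \<phi> \<longrightarrow> eq_conseq {A} (true_eq ` \<Gamma>) (true_eq \<phi>)}"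

lemma eq_conseq_equiv_fm:
  assumes K: "K \<subseteq> RGA"
  shows "eq_conseq K (true_eq ` (\<lambda>(s, t). equiv_fm s t) ` E) (true_eq (equiv_fm s t)) \<longleftrightarrow>
    eq_conseq K E (s, t)"
proof -
  have "(\<forall>d\<in>true_eq ` (\<lambda>(s, t). equiv_fm s t) ` E. sat_eq A v d) \<longleftrightarrow> (\<forall>d\<in>E. sat_eq A v d)"
    "sat_eq A v (true_eq (equiv_fm s t)) \<longleftrightarrow> sat_eq A v (s, t)"
    if "A \<in> K" "range v \<subseteq> carrier A" for A v
    using sat_true_eq_equiv_fm[OF subsetD[OF K that(1)] that(2)] by (auto simp: split_beta)
  then show ?thesis unfolding eq_conseq_def by (metis (no_types, lifting))
qed

lemma logic_cut:
  assumes "logic L" "\<And>\<delta>. \<delta> \<in> \<Delta> \<Longrightarrow> L \<Gamma> \<delta>" "L \<Delta> \<phi>"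
  shows "L \<Gamma> \<phi>"
proof -
  have "\<forall>\<Gamma> \<Delta> \<phi>. (\<forall>\<delta>\<in>\<Delta>. L \<Gamma> \<delta>) \<longrightarrow> L \<Delta> \<phi> \<longrightarrow> L \<Gamma> \<phi>"
    using assms(1) unfolding logic_def by (elim conjE)
  then show ?thesis using assms(2,3) by blast
qed

lemma extension_closed:
  assumes L: "extension_of_RG L" and fin: "finite \<Delta>" and \<Delta>: "\<forall>\<delta>\<in>\<Delta>. L \<Gamma> \<delta>"
    and cons: "eq_conseq (RGA :: nat ralg set) (true_eq ` \<Delta>) (true_eq \<phi>)"
  shows "L \<Gamma> \<phi>"
proof -
  have "RG \<Delta> \<phi>" using fin cons by (auto simp: RG_def)
  then have "L \<Delta> \<phi>" using L by (simp add: extension_of_RG_def)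
  then show ?thesis
    using logic_cut[of L \<Delta> \<Gamma> \<phi>] L \<Delta> by (simp add: extension_of_RG_def)
qed

lemma extension_closed_eq:
  assumes L: "extension_of_RG L" and fin: "finite E" and E: "\<forall>(s, t)\<in>E. L \<Gamma> (equiv_fm s t)"
    and cons: "eq_conseq (RGA :: nat ralg set) E (s, t)"
  shows "L \<Gamma> (equiv_fm s t)"
proof (rule extension_closed[OF L])
  let ?\<Delta> = "(\<lambda>(s, t). equiv_fm s t) ` E"
  show "finite ?\<Delta>" "\<forall>\<delta>\<in>?\<Delta>. L \<Gamma> \<delta>" using fin E by auto
  show "eq_conseq (RGA :: nat ralg set) (true_eq ` ?\<Delta>) (true_eq (equiv_fm s t))"
    using cons by (simp add: eq_conseq_equiv_fm)
qed

text \<open>Consequently the class of \<open>One\<close> in the Lindenbaum-Tarski algebra of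
  \<Gamma> consists of the formulas derivable from \<Gamma>.\<close>

lemma extension_equiv_One:
  assumes L: "extension_of_RG L"
  shows "L \<Gamma> (equiv_fm \<phi> One) \<longleftrightarrow> L \<Gamma> \<phi>"
proof -
  have *: "sat_eq A v (true_eq (equiv_fm \<phi> One)) \<longleftrightarrow> sat_eq A v (true_eq \<phi>)"
    if "A \<in> RGA" "range v \<subseteq> carrier A" for A :: "nat ralg" and v
    using sat_true_eq_equiv_fm[OF that] by (simp add: true_eq_def)
  show ?thesis
    by (rule iffI; rule extension_closed[OF L, of "{_}"]) (auto simp: eq_conseq_def *)
qed

lemma models_finitary:
  assumes "logic L" "L \<Gamma> \<phi>"
  shows "eq_conseq (models L) (true_eq ` \<Gamma>) (true_eq \<phi>)"
proof -
  have "\<forall>\<Gamma> \<phi>. L \<Gamma> \<phi> \<longrightarrow> (\<exists>\<Delta>\<subseteq>\<Gamma>. finite \<Delta> \<and> L \<Delta> \<phi>)"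
    using assms(1) unfolding logic_def by (elim conjE)
  then obtain \<Delta> where "\<Delta> \<subseteq> \<Gamma>" "finite \<Delta>" "L \<Delta> \<phi>"
    using assms(2) by blast
  then have rule: "eq_conseq {A} (true_eq ` \<Delta>) (true_eq \<phi>)" if "A \<in> models L" for A
    using that by (simp add: models_def)
  show ?thesis
    unfolding eq_conseq_def
  proof (intro ballI allI impI)
    fix A v assume "A \<in> models L" "range v \<subseteq> carrier A" "\<forall>d\<in>true_eq ` \<Gamma>. sat_eq A v d"
    then show "sat_eq A v (true_eq \<phi>)"
      using rule[of A] \<open>\<Delta> \<subseteq> \<Gamma>\<close> unfolding eq_conseq_def by blast
  qed
qed

text \<open>The Lindenbaum-Tarski algebra of \<Gamma> satisfies the quasi-equations of
  \<open>RGA\<close> because they are rules of \<open>RG\<close>, and the rules of L because L is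
  substitution invariant. Its canonical valuation makes true exactly what \<Gamma> derives.\<close>

lemma models_complete:
  fixes L :: "fm set \<Rightarrow> fm \<Rightarrow> bool"
  assumes inf: "infinite (UNIV :: 'a set)" and L: "extension_of_RG L"
    and cons: "eq_conseq (models L :: 'a ralg set) (true_eq ` \<Gamma>) (true_eq \<phi>)"
  shows "L \<Gamma> \<phi>"
proof -
  obtain i :: "nat \<Rightarrow> 'a" where i: "inj i" using infinite_countable_subset[OF inf] by blast
  define R where "R s t = L \<Gamma> (equiv_fm s t)" for s t
  \<comment> \<open>Equivalence, congruence and membership of the quotient in \<open>RGA\<close> all
    reduce to this closure under consequence in \<open>RGA\<close>.\<close>
  have R: "R s t" if "finite E" "\<forall>(s, t)\<in>E. R s t" "eq_conseq (RGA :: nat ralg set) E (s, t)" for E s t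
    using extension_closed_eq[OF L that(1) _ that(3)] that(2) by (simp add: R_def)
  have "equivp R"
  proof (rule equivpI)
    show "reflp R" by (rule reflpI, rule R[of "{}"]) (auto simp: eq_conseq_def sat_eq_def)
    show "symp R"
      by (rule sympI, rule R[of "{(_, _)}"]) (auto simp: eq_conseq_def sat_eq_def)
    show "transp R"
    proof (rule transpI)
      fix r s t assume "R r s" "R s t"
      then show "R r t" by (intro R[of "{(r, s), (s, t)}"]) (auto simp: eq_conseq_def sat_eq_def)
    qed
  qed
  moreover have "R (f s t) (f s' t')"
    if "f \<in> {monoid.mult fm_algebra, bmeet fm_algebra, bjoin fm_algebra, bimp fm_algebra}"
      "R s s'" "R t t'" for f s s' t t'
    by (rule R[of "{(s, s'), (t, t')}"])
      (use that in \<open>auto simp: eq_conseq_def sat_eq_def fm_algebra_def\<close>)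
  ultimately obtain C :: "'a ralg" and k where C: "ralg_closed C" and k: "ralg_hom fm_algebra C k"
    and surj: "carrier C = range k" and ker: "k s = k t \<longleftrightarrow> R s t" for s t
    using ralg_quotient[of fm_algebra R "i \<circ> to_nat"] i
    by (auto simp: fm_algebra_def inj_compose)
  have ev: "eval C (k \<circ> \<sigma>) \<psi> = k (subst \<sigma> \<psi>)" for \<sigma> \<psi>
    using eval_hom[OF fm_algebra_closed k] by (simp add: carrier_fm_algebra eval_fm_algebra)
  have val: "\<exists>\<sigma>. v = k \<circ> \<sigma>" if "range v \<subseteq> carrier C" for v
  proof
    have "v n \<in> range k" for n using that surj by auto
    then show "v = k \<circ> (inv_into UNIV k \<circ> v)" by (simp add: fun_eq_iff f_inv_into_f)
  qed
  have "C \<in> RGA"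
  proof (rule RGA_if_quasi_equations[OF C])
    fix E e assume E: "finite E" "eq_conseq (RGA :: nat ralg set) E e"
    show "eq_conseq {C} E e"
      unfolding eq_conseq_def
    proof (intro ballI allI impI)
      fix A v assume "A \<in> {C}" and v: "range v \<subseteq> carrier A" and sat: "\<forall>d\<in>E. sat_eq A v d"
      then have A: "A = C" by simp
      obtain \<sigma> where \<sigma>: "v = k \<circ> \<sigma>" using val v A by blast
      let ?f = "\<lambda>(s, t). (subst \<sigma> s, subst \<sigma> t)"
      have "R (subst \<sigma> (fst e)) (subst \<sigma> (snd e))"
      proof (rule R)
        show "finite (?f ` E)" using E by simp
        show "\<forall>(s, t)\<in>?f ` E. R s t" using sat by (auto simp: A \<sigma> sat_eq_def ev ker)
        show "eq_conseq (RGA :: nat ralg set) (?f ` E) (subst \<sigma> (fst e), subst \<sigma> (snd e))"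
          unfolding eq_conseq_def
        proof (intro ballI allI impI)
          fix B :: "nat ralg" and u
          assume B: "B \<in> RGA" and u: "range u \<subseteq> carrier B" and d: "\<forall>d\<in>?f ` E. sat_eq B u d"
          have "range (\<lambda>n. eval B u (\<sigma> n)) \<subseteq> carrier B"
            using eval_closed[OF _ u] B by (auto simp: RGA_def)
          moreover have "\<forall>d\<in>E. sat_eq B (\<lambda>n. eval B u (\<sigma> n)) d"
            using d by (force simp: sat_eq_def eval_subst)
          ultimately have "sat_eq B (\<lambda>n. eval B u (\<sigma> n)) e"
            using E(2) B unfolding eq_conseq_def by blast
          then show "sat_eq B u (subst \<sigma> (fst e), subst \<sigma> (snd e))"
            by (simp add: sat_eq_def eval_subst)
        qed
      qed
      then show "sat_eq A v e" by (simp add: A \<sigma> sat_eq_def ev ker)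
    qed
  qed
  have one: "sat_eq C (k \<circ> \<sigma>) (true_eq \<psi>) \<longleftrightarrow> L \<Gamma> (subst \<sigma> \<psi>)" for \<sigma> \<psi>
    by (simp only: sat_eq_def true_eq_def fst_conv snd_conv ev ker R_def subst.simps
        extension_equiv_One[OF L])
  have log: "logic L" using L by (simp add: extension_of_RG_def)
  have "C \<in> models L"
    unfolding models_def
  proof (intro CollectI conjI allI impI)
    fix \<Delta> \<psi> assume "L \<Delta> \<psi>"
    then have inst: "L (subst \<sigma> ` \<Delta>) (subst \<sigma> \<psi>)" for \<sigma> using log by (simp add: logic_def)
    have sound: "L \<Gamma> (subst \<sigma> \<psi>)" if "\<forall>\<delta>\<in>\<Delta>. L \<Gamma> (subst \<sigma> \<delta>)" for \<sigma>
      by (rule logic_cut[OF log, of "subst \<sigma> ` \<Delta>"]) (use that inst in auto)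
    show "eq_conseq {C} (true_eq ` \<Delta>) (true_eq \<psi>)"
      unfolding eq_conseq_def
    proof (intro ballI allI impI)
      fix A v assume "A \<in> {C}" "range v \<subseteq> carrier A" and sat: "\<forall>d\<in>true_eq ` \<Delta>. sat_eq A v d"
      then have A: "A = C" and "\<exists>\<sigma>. v = k \<circ> \<sigma>" using val by auto
      then obtain \<sigma> where \<sigma>: "v = k \<circ> \<sigma>" by blast
      show "sat_eq A v (true_eq \<psi>)"
        using sat sound[of \<sigma>] one[of \<sigma>] by (simp add: A \<sigma>)
    qed
  qed fact
  have id: "subst Var \<psi> = \<psi>" for \<psi> by (induction \<psi>) auto
  have "\<forall>d\<in>true_eq ` \<Gamma>. sat_eq C (k \<circ> Var) d"
    using log by (simp add: one id logic_def)
  moreover have "range (k \<circ> Var) \<subseteq> carrier C" using surj by auto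
  ultimately have "sat_eq C (k \<circ> Var) (true_eq \<phi>)"
    using cons \<open>C \<in> models L\<close> unfolding eq_conseq_def by blast
  then show ?thesis by (simp add: one id)
qed

text \<open>The axioms are all quasi-equations valid in \<open>models L\<close>. They include the
  rules of L with finitely many premises and, by \<open>RG_sound\<close>, the quasi-equations of the
  algebras on \<open>nat\<close>, which force their models into \<open>RGA\<close>.\<close>

lemma algebraized_by_models:
  fixes L :: "fm set \<Rightarrow> fm \<Rightarrow> bool"
  assumes inf: "infinite (UNIV :: 'a set)" and L: "extension_of_RG L"
  shows "algebraized_by L (models L :: 'a ralg set)"
proof -
  let ?K = "models L :: 'a ralg set"
  define Q where "Q = {(E, e). finite E \<and> eq_conseq ?K E e}"
  have sub: "?K \<subseteq> RGA" by (auto simp: models_def)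
  have log: "logic L" using L by (simp add: extension_of_RG_def)
  have "?K = {A. ralg_closed A \<and> (\<forall>(E, e)\<in>Q. eq_conseq {A} E e)}"
  proof
    show "?K \<subseteq> {A. ralg_closed A \<and> (\<forall>(E, e)\<in>Q. eq_conseq {A} E e)}"
      using sub by (auto simp: RGA_def Q_def eq_conseq_def)
    show "{A. ralg_closed A \<and> (\<forall>(E, e)\<in>Q. eq_conseq {A} E e)} \<subseteq> ?K"
    proof
      fix A :: "'a ralg"
      assume "A \<in> {A. ralg_closed A \<and> (\<forall>(E, e)\<in>Q. eq_conseq {A} E e)}"
      then have cl: "ralg_closed A" and Q: "\<And>E e. finite E \<Longrightarrow> eq_conseq ?K E e \<Longrightarrow> eq_conseq {A} E e"
        by (auto simp: Q_def)
      have "A \<in> RGA"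
      proof (rule RGA_if_quasi_equations[OF cl Q])
        fix E e assume E: "finite E" "eq_conseq (RGA :: nat ralg set) E e"
        then have "RG ((\<lambda>(s, t). equiv_fm s t) ` E) (equiv_fm (fst e) (snd e))"
          by (auto simp: RG_def eq_conseq_equiv_fm intro!: exI[of _ "(\<lambda>(s, t). equiv_fm s t) ` E"])
        then have "eq_conseq ?K (true_eq ` (\<lambda>(s, t). equiv_fm s t) ` E) (true_eq (equiv_fm (fst e) (snd e)))"
          using sub unfolding eq_conseq_def by (blast intro: RG_sound)
        then show "eq_conseq ?K E e" by (simp add: eq_conseq_equiv_fm[OF sub])
      qed
      moreover have "eq_conseq {A} (true_eq ` \<Gamma>) (true_eq \<phi>)" if "finite \<Gamma>" "L \<Gamma> \<phi>" for \<Gamma> \<phi>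
        by (rule Q) (use that models_finitary[OF log] in auto)
      ultimately show "A \<in> ?K" by (simp add: models_def)
    qed
  qed
  then have "quasivariety ?K" unfolding quasivariety_def by (intro exI[of _ Q]) (auto simp: Q_def)
  moreover have "L \<Gamma> \<phi> \<longleftrightarrow> eq_conseq ?K (true_eq ` \<Gamma>) (true_eq \<phi>)" for \<Gamma> \<phi>
    using models_finitary[OF log] models_complete[OF inf L] by blast
  moreover have "eq_conseq ?K {(s, t)} (true_eq (equiv_fm s t)) \<and>
      eq_conseq ?K {true_eq (equiv_fm s t)} (s, t)" for s t
    using sub sat_true_eq_equiv_fm by (fastforce simp: eq_conseq_def)
  ultimately show ?thesis using sub by (simp add: algebraized_by_def)
qed

section \<open>Joint embedding\<close>

text \<open>Formulas over arbitrary variables: the diagrams of two uncountable algebras need more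
  variables than \<open>fm\<close> has.\<close>

datatype 'v gfm =
    GVar 'v | GZero | GOne | GCst unit_rat
  | GMeet "'v gfm" "'v gfm" | GJoin "'v gfm" "'v gfm" | GMult "'v gfm" "'v gfm" | GImp "'v gfm" "'v gfm"

primrec geval :: "'a ralg \<Rightarrow> ('v \<Rightarrow> 'a) \<Rightarrow> 'v gfm \<Rightarrow> 'a" where
  "geval A v (GVar x) = v x"
| "geval A v GZero = \<zero>\<^bsub>A\<^esub>"
| "geval A v GOne = \<one>\<^bsub>A\<^esub>"
| "geval A v (GCst q) = cst A q"
| "geval A v (GMeet s t) = geval A v s \<curlywedge>\<^bsub>A\<^esub> geval A v t"
| "geval A v (GJoin s t) = geval A v s \<curlyvee>\<^bsub>A\<^esub> geval A v t"
| "geval A v (GMult s t) = geval A v s \<otimes>\<^bsub>A\<^esub> geval A v t"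
| "geval A v (GImp s t) = geval A v s \<leadsto>\<^bsub>A\<^esub> geval A v t"

definition gfm_algebra :: "'v gfm ralg" where
  "gfm_algebra = \<lparr>carrier = UNIV, monoid.mult = GMult, one = GOne, bmeet = GMeet, bjoin = GJoin,
     bimp = GImp, bzero = GZero, cst = GCst\<rparr>"

lemma carrier_gfm_algebra: "carrier gfm_algebra = UNIV"
  by (simp add: gfm_algebra_def)

lemma gfm_algebra_closed: "ralg_closed gfm_algebra"
  by (simp add: ralg_closed_def gfm_algebra_def)

lemma geval_closed:
  assumes "ralg_closed A" "range v \<subseteq> carrier A"
  shows "geval A v \<phi> \<in> carrier A"
  using assms by (induction \<phi>) (auto simp: ralg_closed_def)

lemma geval_gfm_algebra_hom:
  assumes "ralg_closed A" "range v \<subseteq> carrier A"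
  shows "ralg_hom gfm_algebra A (geval A v)"
  using geval_closed[OF assms] by (auto simp: ralg_hom_def gfm_algebra_def)

lemma geval_cong: "(\<And>x. x \<in> set_gfm \<phi> \<Longrightarrow> u x = v x) \<Longrightarrow> geval A u \<phi> = geval A v \<phi>"
  by (induction \<phi>) auto

lemma geval_cst:
  assumes "A \<in> RGA"
  shows "geval A (cst A \<circ> \<kappa>) \<phi> = cst A (geval rational_goedel \<kappa> \<phi>)"
  by (induction \<phi>) (simp_all add: cst_ops[OF assms] rational_goedel_simps(2,3) rational_goedel_def)

lemma eval_cst:
  assumes "A \<in> RGA"
  shows "eval A (cst A \<circ> \<kappa>) \<phi> = cst A (eval rational_goedel \<kappa> \<phi>)"
  by (rule eval_hom[OF rational_goedel_closed cst_hom[OF assms]]) (simp add: rational_goedel_simps)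

primrec fm_of_gfm :: "('v \<Rightarrow> nat) \<Rightarrow> 'v gfm \<Rightarrow> fm" where
  "fm_of_gfm g (GVar x) = Var (g x)"
| "fm_of_gfm g GZero = Zero"
| "fm_of_gfm g GOne = One"
| "fm_of_gfm g (GCst q) = Cst q"
| "fm_of_gfm g (GMeet s t) = Meet (fm_of_gfm g s) (fm_of_gfm g t)"
| "fm_of_gfm g (GJoin s t) = Join (fm_of_gfm g s) (fm_of_gfm g t)"
| "fm_of_gfm g (GMult s t) = Mult (fm_of_gfm g s) (fm_of_gfm g t)"
| "fm_of_gfm g (GImp s t) = Imp (fm_of_gfm g s) (fm_of_gfm g t)"

lemma eval_fm_of_gfm: "eval A v (fm_of_gfm g \<phi>) = geval A (v \<circ> g) \<phi>"
  by (induction \<phi>) auto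

text \<open>Finitely many equations mention finitely many variables, and these can be renamed to
  variables of \<open>fm\<close>.\<close>

lemma constant_solution_gfm:
  fixes \<Delta> :: "('v gfm \<times> 'v gfm) set"
  assumes A: "A \<in> RGA" and nontriv: "nontrivial A" and fin: "finite \<Delta>"
    and u: "range u \<subseteq> carrier A" and sat: "\<And>s t. (s, t) \<in> \<Delta> \<Longrightarrow> geval A u s = geval A u t"
  shows "\<exists>\<kappa>. \<forall>(s, t)\<in>\<Delta>. cst A (geval rational_goedel \<kappa> s) = cst A (geval rational_goedel \<kappa> t)"
proof -
  define X where "X = (\<Union>(s, t)\<in>\<Delta>. set_gfm s \<union> set_gfm t)"
  have "finite (set_gfm \<phi>)" for \<phi> :: "'v gfm" by (induction \<phi>) auto
  then have "finite X" using fin by (auto simp: X_def)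
  from finite_imp_inj_to_nat_seg[OF this] obtain g :: "'v \<Rightarrow> nat" where g: "inj_on g X" by blast
  \<comment> \<open>For n outside the image of X this is some value of u, still in the
    carrier.\<close>
  define v where "v n = u (inv_into X g n)" for n
  have v: "range v \<subseteq> carrier A" using u by (auto simp: v_def)
  have vg: "geval A (v \<circ> g) \<phi> = geval A u \<phi>" if "set_gfm \<phi> \<subseteq> X" for \<phi>
    by (rule geval_cong) (use that g in \<open>simp add: v_def subset_iff\<close>)
  let ?f = "fm_of_gfm g"
  have cstv: "range (cst A \<circ> \<kappa>) \<subseteq> carrier A" for \<kappa> :: "nat \<Rightarrow> unit_rat"
    using A by (auto simp: RGA_def ralg_closed_def)
  have iff: "eval A w (equiv_fm s t) = \<one>\<^bsub>A\<^esub> \<longleftrightarrow> eval A w s = eval A w t"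
    if "range w \<subseteq> carrier A" for w s t
    using sat_true_eq_equiv_fm[OF A that, of s t] by (simp add: sat_eq_def true_eq_def)
  have "\<exists>\<kappa>. \<forall>\<gamma>\<in>(\<lambda>(s, t). equiv_fm (?f s) (?f t)) ` \<Delta>. eval A (cst A \<circ> \<kappa>) \<gamma> = \<one>\<^bsub>A\<^esub>"
  proof (rule constant_solution_fm[OF A nontriv _ v])
    show "finite ((\<lambda>(s, t). equiv_fm (?f s) (?f t)) ` \<Delta>)" using fin by simp
    have "eval A v (equiv_fm (?f s) (?f t)) = \<one>\<^bsub>A\<^esub>" if "(s, t) \<in> \<Delta>" for s t
    proof -
      have "set_gfm s \<subseteq> X" "set_gfm t \<subseteq> X" using that by (auto simp: X_def)
      then show ?thesis using sat[OF that] by (simp add: iff[OF v] eval_fm_of_gfm vg)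
    qed
    then show "\<forall>\<gamma>\<in>(\<lambda>(s, t). equiv_fm (?f s) (?f t)) ` \<Delta>. eval A v \<gamma> = \<one>\<^bsub>A\<^esub>" by auto
  qed
  then obtain \<kappa> where "\<forall>(s, t)\<in>\<Delta>. eval A (cst A \<circ> \<kappa>) (?f s) = eval A (cst A \<circ> \<kappa>) (?f t)"
    by (auto simp: split_beta iff[OF cstv])
  then have "\<forall>(s, t)\<in>\<Delta>. cst A (geval rational_goedel (\<kappa> \<circ> g) s) = cst A (geval rational_goedel (\<kappa> \<circ> g) t)"
    by (simp add: eval_fm_of_gfm comp_assoc geval_cst[OF A])
  then show ?thesis by blast
qed

section \<open>Coding terms in an infinite type\<close>

lemma inj_pair_if_infinite:
  assumes "infinite (UNIV :: 'a set)"
  shows "\<exists>f :: 'a \<times> 'a \<Rightarrow> 'a. inj f"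
  using card_of_Times_same_infinite[OF assms] unfolding card_of_ordIso[symmetric]
  by (auto simp: bij_betw_def)

text \<open>Tagged pairing: n supplies distinct tags, and the filler \<open>n 0\<close> makes the
  codes of \<open>GZero\<close> and \<open>GOne\<close> pairs too. Decoding is by induction on
  terms, so injectivity of p, n and i suffices.\<close>

primrec gfm_code :: "('a \<times> 'a \<Rightarrow> 'a) \<Rightarrow> (nat \<Rightarrow> 'a) \<Rightarrow> ('v \<Rightarrow> 'a) \<Rightarrow> 'v gfm \<Rightarrow> 'a" where
  "gfm_code p n i (GVar x) = p (n 0, i x)"
| "gfm_code p n i GZero = p (n 1, n 0)"
| "gfm_code p n i GOne = p (n 2, n 0)"
| "gfm_code p n i (GCst q) = p (n 3, n (to_nat q))"
| "gfm_code p n i (GMeet s t) = p (n 4, p (gfm_code p n i s, gfm_code p n i t))"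
| "gfm_code p n i (GJoin s t) = p (n 5, p (gfm_code p n i s, gfm_code p n i t))"
| "gfm_code p n i (GMult s t) = p (n 6, p (gfm_code p n i s, gfm_code p n i t))"
| "gfm_code p n i (GImp s t) = p (n 7, p (gfm_code p n i s, gfm_code p n i t))"

lemma inj_gfm_if_infinite:
  fixes i :: "'v \<Rightarrow> 'a"
  assumes inf: "infinite (UNIV :: 'a set)" and i: "inj i"
  shows "\<exists>e :: 'v gfm \<Rightarrow> 'a. inj e"
proof -
  obtain p :: "'a \<times> 'a \<Rightarrow> 'a" where p: "inj p" using inj_pair_if_infinite[OF inf] by blast
  obtain n :: "nat \<Rightarrow> 'a" where n: "inj n" using infinite_countable_subset[OF inf] by blast
  have "gfm_code p n i s = gfm_code p n i t \<Longrightarrow> s = t" for s t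
    by (induction s arbitrary: t; case_tac t; simp add: inj_eq[OF p] inj_eq[OF n] inj_eq[OF i])
  then have "inj (gfm_code p n i)" by (rule injI)
  then show ?thesis by blast
qed

section \<open>Algebras presented by generators and relations\<close>

definition consequence ::
  "'a ralg set \<Rightarrow> ('v gfm \<times> 'v gfm) set \<Rightarrow> 'v gfm \<Rightarrow> 'v gfm \<Rightarrow> bool" where
  "consequence K \<Delta> s t \<longleftrightarrow> (\<forall>A\<in>K. \<forall>u. range u \<subseteq> carrier A \<longrightarrow>
     (\<forall>(x, y)\<in>\<Delta>. geval A u x = geval A u y) \<longrightarrow> geval A u s = geval A u t)"

text \<open>Finiteness is built in and takes the place of a compactness theorem for K: only finite
  parts of a diagram will ever have to be solved.\<close>

definition finite_consequence ::
  "'a ralg set \<Rightarrow> ('v gfm \<times> 'v gfm) set \<Rightarrow> 'v gfm \<Rightarrow> 'v gfm \<Rightarrow> bool" where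
  "finite_consequence K D s t \<longleftrightarrow> (\<exists>\<Delta>\<subseteq>D. finite \<Delta> \<and> consequence K \<Delta> s t)"

lemma finite_consequence_combine:
  assumes "finite I" "\<And>i. i \<in> I \<Longrightarrow> finite_consequence K D (f i) (g i)"
    and "\<And>A u. A \<in> K \<Longrightarrow> range u \<subseteq> carrier A \<Longrightarrow> (\<And>i. i \<in> I \<Longrightarrow> geval A u (f i) = geval A u (g i))
      \<Longrightarrow> geval A u s = geval A u t"
  shows "finite_consequence K D s t"
proof -
  have "\<forall>i\<in>I. \<exists>\<Delta>. \<Delta> \<subseteq> D \<and> finite \<Delta> \<and> consequence K \<Delta> (f i) (g i)"
    using assms(2) by (simp add: finite_consequence_def)
  then obtain F where F: "\<forall>i\<in>I. F i \<subseteq> D \<and> finite (F i) \<and> consequence K (F i) (f i) (g i)"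
    by (rule bchoice[THEN exE])
  show ?thesis
    unfolding finite_consequence_def consequence_def
  proof (intro exI[of _ "\<Union>(F ` I)"] conjI ballI allI impI)
    show "\<Union>(F ` I) \<subseteq> D" "finite (\<Union>(F ` I))" using F assms(1) by auto
    fix A u assume A: "A \<in> K" and u: "range u \<subseteq> carrier A"
      and d: "\<forall>(x, y)\<in>\<Union>(F ` I). geval A u x = geval A u y"
    have "geval A u (f i) = geval A u (g i)" if "i \<in> I" for i
    proof -
      have "consequence K (F i) (f i) (g i)" using F that by blast
      moreover have "\<forall>(x, y)\<in>F i. geval A u x = geval A u y" using d that by blast
      ultimately show ?thesis using A u unfolding consequence_def by blast
    qed
    then show "geval A u s = geval A u t" by (rule assms(3)[OF A u])
  qed
qed

text \<open>The member of K with generators \<open>'v\<close> and relations D. It satisfies the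
  quasi-equations of K because a finite set of premises draws on finitely many relations
  altogether.\<close>

lemma presented_algebra:
  fixes K :: "'a ralg set" and D :: "('v gfm \<times> 'v gfm) set" and e :: "'v gfm \<Rightarrow> 'a"
  assumes K: "quasivariety K" and e: "inj e"
  shows "\<exists>C\<in>K. \<exists>k. ralg_hom gfm_algebra C k \<and> (\<forall>s t. k s = k t \<longleftrightarrow> finite_consequence K D s t)"
proof -
  let ?R = "finite_consequence K D"
  have two: "?R s'' t''" if "?R s t" "?R s' t'"
    and imp: "\<And>(A :: 'a ralg) u. geval A u s = geval A u t \<Longrightarrow> geval A u s' = geval A u t' \<Longrightarrow>
      geval A u s'' = geval A u t''"
    for s t s' t' s'' t''
  proof (rule finite_consequence_combine[of "{(s, t), (s', t')}" K D fst snd])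
    show "?R (fst i) (snd i)" if "i \<in> {(s, t), (s', t')}" for i
      using that \<open>?R s t\<close> \<open>?R s' t'\<close> by auto
    show "geval A u s'' = geval A u t''"
      if "\<And>i. i \<in> {(s, t), (s', t')} \<Longrightarrow> geval A u (fst i) = geval A u (snd i)" for A :: "'a ralg" and u
      using that(1)[of "(s, t)"] that(1)[of "(s', t')"]imp
      by simp
  qed simp
  have "equivp ?R"
  proof (rule equivpI)
    show "reflp ?R"
      by (rule reflpI, rule finite_consequence_combine[of "{}"]) auto
    show "symp ?R"
    proof (rule sympI)
      fix s t assume "?R s t"
      from this this show "?R t s" by (rule two) simp
    qed
    show "transp ?R"
    proof (rule transpI)
      fix r s t assume "?R r s" "?R s t"
      then show "?R r t" by (rule two) simp
    qed
  qed
  moreover have "?R (f s t) (f s' t')"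
    if "f \<in> {monoid.mult gfm_algebra, bmeet gfm_algebra, bjoin gfm_algebra, bimp gfm_algebra}"
      "?R s s'" "?R t t'" for f s s' t t'
    using that(1) by (intro two[OF that(2,3)]) (auto simp: gfm_algebra_def)
  ultimately obtain C :: "'a ralg" and k where C: "ralg_closed C" and k: "ralg_hom gfm_algebra C k"
    and surj: "carrier C = range k" and ker: "\<And>s t. k s = k t \<longleftrightarrow> ?R s t"
    using ralg_quotient[OF carrier_gfm_algebra _ e, of ?R] by blast
  have ev: "eval C (k \<circ> \<tau>) \<psi> = k (eval gfm_algebra \<tau> \<psi>)" for \<tau> \<psi>
    by (rule eval_hom[OF gfm_algebra_closed k]) (simp add: carrier_gfm_algebra)
  obtain Q where fin: "\<forall>(E, e)\<in>Q. finite E"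
    and Q: "K = {A. ralg_closed A \<and> (\<forall>(E, e)\<in>Q. eq_conseq {A} E e)}"
    using K by (auto simp: quasivariety_def)
  have "eq_conseq {C} E e" if Ee: "(E, e) \<in> Q" for E e
    unfolding eq_conseq_def
  proof (intro ballI allI impI)
    fix A v assume "A \<in> {C}" and v: "range v \<subseteq> carrier A" and sat: "\<forall>d\<in>E. sat_eq A v d"
    then have A: "A = C" by simp
    \<comment> \<open>Lifting the valuation to terms turns premises true in C into term equations
      derivable from finite parts of D.\<close>
    define \<tau> where "\<tau> = inv_into UNIV k \<circ> v"
    have "v n \<in> range k" for n using v surj A by auto
    then have v_eq: "v = k \<circ> \<tau>" by (simp add: fun_eq_iff f_inv_into_f \<tau>_def)
    let ?g = "eval gfm_algebra \<tau>"
    have "?R (?g (fst e)) (?g (snd e))"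
    proof (rule finite_consequence_combine[of E K D "\<lambda>d. ?g (fst d)" "\<lambda>d. ?g (snd d)"])
      show "finite E" using fin Ee by blast
      show "?R (?g (fst d)) (?g (snd d))" if "d \<in> E" for d
        using sat that by (simp add: A v_eq sat_eq_def ev ker)
      fix B u assume B: "B \<in> K" and u: "range u \<subseteq> carrier B"
        and d: "\<And>d. d \<in> E \<Longrightarrow> geval B u (?g (fst d)) = geval B u (?g (snd d))"
      have clB: "ralg_closed B" and BE: "eq_conseq {B} E e" using B Q Ee by auto
      have evB: "eval B (geval B u \<circ> \<tau>) \<psi> = geval B u (?g \<psi>)" for \<psi>
        by (rule eval_hom[OF gfm_algebra_closed geval_gfm_algebra_hom[OF clB u]])
          (simp add: carrier_gfm_algebra)
      have "\<forall>d\<in>E. sat_eq B (geval B u \<circ> \<tau>) d" using d by (simp add: sat_eq_def evB)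
      moreover have "range (geval B u \<circ> \<tau>) \<subseteq> carrier B" using geval_closed[OF clB u] by auto
      ultimately have "sat_eq B (geval B u \<circ> \<tau>) e" using BE unfolding eq_conseq_def by blast
      then show "geval B u (?g (fst e)) = geval B u (?g (snd e))" by (simp add: sat_eq_def evB)
    qed
    then show "sat_eq A v e" by (simp add: A v_eq sat_eq_def ev ker)
  qed
  then have "C \<in> K" using C Q by auto
  then show ?thesis using k ker by blast
qed

text \<open>Only equations occur; distinctness of elements is recovered from
  \<open>diagram_conservative\<close>. The tag b keeps the variables of two algebras apart even if
  their carriers overlap.\<close>

definition diagram :: "('i \<Rightarrow> 'a ralg) \<Rightarrow> 'i \<Rightarrow> (('i \<times> 'a) gfm \<times> ('i \<times> 'a) gfm) set" where
  "diagram M b = {(s, t). set_gfm s \<union> set_gfm t \<subseteq> {b} \<times> carrier (M b) \<and>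
     geval (M b) snd s = geval (M b) snd t}"

text \<open>A finite part of the diagram of one algebra has a solution by constants there, hence in the
  other algebra, so it causes no new identifications in the latter.\<close>

lemma diagram_conservative:
  fixes M :: "bool \<Rightarrow> 'a ralg"
  assumes MR: "\<And>b. M b \<in> RGA" and nt: "\<And>b. nontrivial (M b)" and tops: "\<And>b c. tops (M b) = tops (M c)"
    and \<Delta>: "\<Delta> \<subseteq> \<Union>(range (diagram M))" "finite \<Delta>"
  shows "\<exists>u. range u \<subseteq> carrier (M b) \<and> (\<forall>x\<in>carrier (M b). u (b, x) = x) \<and>
    (\<forall>(s, t)\<in>\<Delta>. geval (M b) u s = geval (M b) u t)"
proof -
  have Mcl: "ralg_closed (M c)" for c using MR by (simp add: RGA_def)
  \<comment> \<open>A variable may carry an element outside the carrier; 1 is the default that keeps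
    w a valuation.\<close>
  define w where "w c z = (if snd z \<in> carrier (M c) then snd z else \<one>\<^bsub>M c\<^esub>)" for c and z :: "bool \<times> 'a"
  have w: "range (w c) \<subseteq> carrier (M c)" for c
    using Mcl[of c] by (auto simp: w_def ralg_closed_def)
  have wg: "geval (M c) (w c) s = geval (M c) snd s" if "set_gfm s \<subseteq> {c} \<times> carrier (M c)" for c s
    by (rule geval_cong) (use that in \<open>auto simp: w_def\<close>)
  have "\<exists>\<kappa>. \<forall>(s, t)\<in>\<Delta> \<inter> diagram M (\<not> b).
      cst (M (\<not> b)) (geval rational_goedel \<kappa> s) = cst (M (\<not> b)) (geval rational_goedel \<kappa> t)"
    by (rule constant_solution_gfm[OF MR nt _ w]) (use \<Delta> wg in \<open>auto simp: diagram_def\<close>)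
  then obtain \<kappa> where "\<forall>(s, t)\<in>\<Delta> \<inter> diagram M (\<not> b).
      cst (M (\<not> b)) (geval rational_goedel \<kappa> s) = cst (M (\<not> b)) (geval rational_goedel \<kappa> t)" ..
  \<comment> \<open>Whether two constants agree depends on \<open>tops\<close> alone, so the
    solution found in the other algebra is a solution here.\<close>
  then have \<kappa>: "geval (M b) (cst (M b) \<circ> \<kappa>) s = geval (M b) (cst (M b) \<circ> \<kappa>) t"
    if "(s, t) \<in> \<Delta>" "(s, t) \<in> diagram M (\<not> b)" for s t
    using that unfolding geval_cst[OF MR] cst_eq_iff[OF MR] tops[of "\<not> b" b] by blast
  define u where "u z = (if fst z = b then w b z else cst (M b) (\<kappa> z))" for z
  have "range u \<subseteq> carrier (M b)"
    using w[of b] Mcl[of b] by (auto simp: u_def ralg_closed_def image_subset_iff)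
  moreover have "\<forall>x\<in>carrier (M b). u (b, x) = x" by (simp add: u_def w_def)
  moreover have "geval (M b) u s = geval (M b) u t" if st: "(s, t) \<in> \<Delta>" for s t
  proof -
    obtain c where c: "(s, t) \<in> diagram M c" using \<Delta> st by blast
    have vars: "set_gfm s \<subseteq> {c} \<times> carrier (M c)" "set_gfm t \<subseteq> {c} \<times> carrier (M c)"
      using c by (auto simp: diagram_def)
    show ?thesis
    proof (cases "c = b")
      case True
      have "geval (M b) u r = geval (M b) (w b) r" if "set_gfm r \<subseteq> {c} \<times> carrier (M c)" for r
        by (rule geval_cong) (use that True in \<open>auto simp: u_def\<close>)
      then show ?thesis using c True wg vars by (simp add: diagram_def)
    next
      case False
      then have "(s, t) \<in> diagram M (\<not> b)" using c by (cases c; cases b) auto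
      moreover have "geval (M b) u r = geval (M b) (cst (M b) \<circ> \<kappa>) r"
        if "set_gfm r \<subseteq> {c} \<times> carrier (M c)" for r
        by (rule geval_cong) (use that False in \<open>auto simp: u_def\<close>)
      ultimately show ?thesis using \<kappa>[OF st] vars by simp
    qed
  qed
  ultimately show ?thesis by blast
qed

text \<open>The common extension is presented by both diagrams together. The diagrams yield the
  homomorphisms, and conservativity yields injectivity.\<close>

lemma joint_embedding_if_tops_eq:
  fixes K :: "'a ralg set"
  assumes inf: "infinite (UNIV :: 'a set)" and K: "quasivariety K" and sub: "K \<subseteq> RGA"
    and tops: "\<And>A B. A \<in> K \<Longrightarrow> B \<in> K \<Longrightarrow> nontrivial A \<Longrightarrow> nontrivial B \<Longrightarrow> tops A = tops B"
  shows "joint_embedding K"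
  unfolding joint_embedding_def
proof (intro ballI impI)
  fix A B assume AB: "A \<in> K" "B \<in> K" "nontrivial A" "nontrivial B"
  define M where "M b = (if b then A else B)" for b
  have MK: "M b \<in> K" and MR: "M b \<in> RGA" and Mnt: "nontrivial (M b)" for b
    using AB sub by (auto simp: M_def)
  have Mt: "tops (M b) = tops (M c)" for b c by (rule tops[OF MK MK Mnt Mnt])
  have Mcl: "ralg_closed (M b)" for b using MR by (simp add: RGA_def)
  obtain p :: "'a \<times> 'a \<Rightarrow> 'a" where p: "inj p" using inj_pair_if_infinite[OF inf] by blast
  obtain n :: "nat \<Rightarrow> 'a" where n: "inj n" using infinite_countable_subset[OF inf] by blast
  have "inj (\<lambda>(b :: bool, x). p (n (of_bool b), x))"
    by (auto simp: inj_def inj_eq[OF p] inj_eq[OF n])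
  then obtain e :: "(bool \<times> 'a) gfm \<Rightarrow> 'a" where e: "inj e"
    using inj_gfm_if_infinite[OF inf] by blast
  let ?D = "\<Union>(range (diagram M))"
  obtain C k where C: "C \<in> K" and k: "ralg_hom gfm_algebra C k"
    and ker: "\<And>s t. k s = k t \<longleftrightarrow> finite_consequence K ?D s t"
    using presented_algebra[OF K e, of ?D] by blast
  have kdiag: "k s = k t" if "(s, t) \<in> diagram M b" for s t b
    unfolding ker finite_consequence_def consequence_def by (rule exI[of _ "{(s, t)}"]) (use that in auto)
  have khom: "k (GMult s t) = k s \<otimes>\<^bsub>C\<^esub> k t" "k (GMeet s t) = k s \<curlywedge>\<^bsub>C\<^esub> k t"
    "k (GJoin s t) = k s \<curlyvee>\<^bsub>C\<^esub> k t" "k (GImp s t) = k s \<leadsto>\<^bsub>C\<^esub> k t"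
    "k GZero = \<zero>\<^bsub>C\<^esub>" "k GOne = \<one>\<^bsub>C\<^esub>" "k (GCst q) = cst C q" "k s \<in> carrier C" for s t q
    using k by (auto simp: ralg_hom_def gfm_algebra_def)
  have "embedding (M b) C (\<lambda>x. k (GVar (b, x)))" for b
    unfolding embedding_def
  proof
    have clM: "\<zero>\<^bsub>M b\<^esub> \<in> carrier (M b)" "\<one>\<^bsub>M b\<^esub> \<in> carrier (M b)" "cst (M b) q \<in> carrier (M b)" for q
      using Mcl by (auto simp: ralg_closed_def)
    have clop: "x \<otimes>\<^bsub>M b\<^esub> y \<in> carrier (M b)" "x \<curlywedge>\<^bsub>M b\<^esub> y \<in> carrier (M b)"
      "x \<curlyvee>\<^bsub>M b\<^esub> y \<in> carrier (M b)" "x \<leadsto>\<^bsub>M b\<^esub> y \<in> carrier (M b)"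
      if "x \<in> carrier (M b)" "y \<in> carrier (M b)" for x y
      using Mcl[of b] that by (auto simp: ralg_closed_def)
    \<comment> \<open>A term and the variable naming its value form a diagram equation. Terms with a
      single operation symbol then give the homomorphism laws.\<close>
    have kd: "k (GVar (b, geval (M b) snd t)) = k t"
      if "set_gfm t \<subseteq> {b} \<times> carrier (M b)" "geval (M b) snd t \<in> carrier (M b)" for t
      by (rule kdiag[of _ _ b]) (use that in \<open>auto simp: diagram_def\<close>)
    show "ralg_hom (M b) C (\<lambda>x. k (GVar (b, x)))"
      unfolding ralg_hom_def
    proof (intro conjI ballI allI)
      fix x y assume xy: "x \<in> carrier (M b)" "y \<in> carrier (M b)"
      show "k (GVar (b, x \<otimes>\<^bsub>M b\<^esub> y)) = k (GVar (b, x)) \<otimes>\<^bsub>C\<^esub> k (GVar (b, y))"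
        using kd[of "GMult (GVar (b, x)) (GVar (b, y))"] xy clop by (simp add: khom)
      show "k (GVar (b, x \<curlywedge>\<^bsub>M b\<^esub> y)) = k (GVar (b, x)) \<curlywedge>\<^bsub>C\<^esub> k (GVar (b, y))"
        using kd[of "GMeet (GVar (b, x)) (GVar (b, y))"] xy clop by (simp add: khom)
      show "k (GVar (b, x \<curlyvee>\<^bsub>M b\<^esub> y)) = k (GVar (b, x)) \<curlyvee>\<^bsub>C\<^esub> k (GVar (b, y))"
        using kd[of "GJoin (GVar (b, x)) (GVar (b, y))"] xy clop by (simp add: khom)
      show "k (GVar (b, x \<leadsto>\<^bsub>M b\<^esub> y)) = k (GVar (b, x)) \<leadsto>\<^bsub>C\<^esub> k (GVar (b, y))"
        using kd[of "GImp (GVar (b, x)) (GVar (b, y))"] xy clop by (simp add: khom)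
    next
      show "k (GVar (b, cst (M b) q)) = cst C q" for q
        using kd[of "GCst q"] clM by (simp add: khom)
    qed (use kd[of GZero] kd[of GOne] clM khom in auto)
    show "inj_on (\<lambda>x. k (GVar (b, x))) (carrier (M b))"
    proof (rule inj_onI)
      fix x y assume xy: "x \<in> carrier (M b)" "y \<in> carrier (M b)" "k (GVar (b, x)) = k (GVar (b, y))"
      \<comment> \<open>An equality in C rests on finitely many relations. The algebra
        \<open>M b\<close> is itself in K, so it can be tested there by a valuation that fixes the
        elements of \<open>M b\<close>.\<close>
      then obtain \<Delta> where \<Delta>: "\<Delta> \<subseteq> ?D" "finite \<Delta>"
        and cons: "\<And>D u. D \<in> K \<Longrightarrow> range u \<subseteq> carrier D \<Longrightarrow>
          \<forall>(x, y)\<in>\<Delta>. geval D u x = geval D u y \<Longrightarrow> u (b, x) = u (b, y)"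
        unfolding ker finite_consequence_def consequence_def by auto
      obtain u where "range u \<subseteq> carrier (M b)" "\<forall>x\<in>carrier (M b). u (b, x) = x"
        "\<forall>(s, t)\<in>\<Delta>. geval (M b) u s = geval (M b) u t"
        using diagram_conservative[where M = M and b = b, OF MR Mnt Mt \<Delta>] by blast
      then show "x = y" using cons[OF MK] xy by metis
    qed
  qed
  from this[of True] this[of False] C
  show "\<exists>C\<in>K. (\<exists>f. embedding A C f) \<and> (\<exists>g. embedding B C g)"
    by (auto simp: M_def)
qed

section \<open>Passive structural completeness\<close>

lemma tops_eq_if_joint_embedding:
  fixes K :: "'a ralg set"
  assumes "joint_embedding K" "K \<subseteq> RGA" "A \<in> K" "B \<in> K" "nontrivial A" "nontrivial B"
  shows "tops A = tops B"
proof -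
  obtain C :: "'a ralg" and f g where "embedding A C f" "embedding B C g"
    using assms unfolding joint_embedding_def by blast
  moreover have "ralg_closed A" "ralg_closed B" using assms by (auto simp: RGA_def)
  ultimately show ?thesis using tops_embedding by metis
qed

lemma tops_subset_if_passively_structurally_complete:
  assumes L: "algebraized_by L K" and psc: "passively_structurally_complete L"
    and A: "A \<in> K" "nontrivial A" and B: "B \<in> K" "nontrivial B"
  shows "tops A \<subseteq> tops B"
proof
  have sub: "K \<subseteq> RGA" and alg: "\<And>\<Gamma> \<phi>. L \<Gamma> \<phi> \<longleftrightarrow> eq_conseq K (true_eq ` \<Gamma>) (true_eq \<phi>)"
    using L by (auto simp: algebraized_by_def)
  have one: "range (\<lambda>_. \<one>\<^bsub>C\<^esub>) \<subseteq> carrier C" if "C \<in> K" for C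
    using that sub by (auto simp: RGA_def ralg_closed_def)
  fix q assume q: "q \<in> tops A"
  show "q \<in> tops B"
  proof (rule ccontr)
    assume nq: "q \<notin> tops B"
    have "\<not> L {} (Cst q)"
    proof
      assume "L {} (Cst q)"
      then have "sat_eq B (\<lambda>_. \<one>\<^bsub>B\<^esub>) (true_eq (Cst q))"
        using B(1) one[OF B(1)] by (auto simp: alg eq_conseq_def)
      then show False using nq by (simp add: sat_eq_def true_eq_def tops_def)
    qed
    \<comment> \<open>Substitutions leave \<open>Cst q\<close> unchanged, so the premise is passive
      once it is not a theorem.\<close>
    then have "passive_premises L {Cst q}" by (simp add: passive_premises_def)
    then have "L {Cst q} Zero" using psc by (simp add: passively_structurally_complete_def)
    moreover have "sat_eq A (\<lambda>_. \<one>\<^bsub>A\<^esub>) (true_eq (Cst q))"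
      using q by (simp add: sat_eq_def true_eq_def tops_def)
    ultimately have "sat_eq A (\<lambda>_. \<one>\<^bsub>A\<^esub>) (true_eq Zero)"
      using A(1) one[OF A(1)] by (auto simp: alg eq_conseq_def)
    then have "\<zero>\<^bsub>A\<^esub> = \<one>\<^bsub>A\<^esub>" by (simp add: sat_eq_def true_eq_def)
    then show False using A sub nontrivial_iff by blast
  qed
qed

lemma passively_structurally_complete_if_tops_eq:
  fixes K :: "'a ralg set"
  assumes L: "algebraized_by L K"
    and tops: "\<And>A B. A \<in> K \<Longrightarrow> B \<in> K \<Longrightarrow> nontrivial A \<Longrightarrow> nontrivial B \<Longrightarrow> tops A = tops B"
  shows "passively_structurally_complete L"
  unfolding passively_structurally_complete_def
proof (intro allI impI)
  have sub: "K \<subseteq> RGA" and alg: "\<And>\<Gamma> \<phi>. L \<Gamma> \<phi> \<longleftrightarrow> eq_conseq K (true_eq ` \<Gamma>) (true_eq \<phi>)"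
    using L by (auto simp: algebraized_by_def)
  fix \<Gamma> \<phi> assume fin: "finite \<Gamma>" and pas: "passive_premises L \<Gamma>"
  show "L \<Gamma> \<phi>"
    unfolding alg eq_conseq_def
  proof (intro ballI allI impI)
    fix A v assume A: "A \<in> K" and v: "range v \<subseteq> carrier A" and sat: "\<forall>d\<in>true_eq ` \<Gamma>. sat_eq A v d"
    have AR: "A \<in> RGA" using A sub by blast
    then have clA: "ralg_closed A" by (simp add: RGA_def)
    show "sat_eq A v (true_eq \<phi>)"
    proof (rule ccontr)
      assume "\<not> ?thesis"
      then have nt: "nontrivial A"
        using eval_closed[OF clA v, of \<phi>] eval_closed[OF clA v, of One]
        unfolding nontrivial_def sat_eq_def true_eq_def fst_conv snd_conv by blast
      obtain \<kappa> where \<kappa>: "\<forall>\<gamma>\<in>\<Gamma>. eval A (cst A \<circ> \<kappa>) \<gamma> = \<one>\<^bsub>A\<^esub>"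
        using constant_solution_fm[OF AR nt fin v] sat by (auto simp: sat_eq_def true_eq_def)
      have "L {} (subst (Cst \<circ> \<kappa>) \<gamma>)" if "\<gamma> \<in> \<Gamma>" for \<gamma>
        unfolding alg eq_conseq_def
      proof (intro ballI allI impI)
        fix B and w :: "nat \<Rightarrow> 'a" assume B: "B \<in> K" and w: "range w \<subseteq> carrier B"
        have BR: "B \<in> RGA" using B sub by blast
        then have clB: "ralg_closed B" by (simp add: RGA_def)
        have ev: "eval B w (subst (Cst \<circ> \<kappa>) \<gamma>) = cst B (eval rational_goedel \<kappa> \<gamma>)"
          using eval_cst[OF BR, of \<kappa> \<gamma>] by (simp add: eval_subst comp_def)
        \<comment> \<open>The value of \<gamma> under \<kappa> is one rational, computed
          independently of the algebra; equality of \<open>tops\<close> carries its being 1 from A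
          to every nontrivial B.\<close>
        have "eval rational_goedel \<kappa> \<gamma> \<in> tops A"
          using \<kappa> that by (simp add: tops_def eval_cst[OF AR])
        then have "eval rational_goedel \<kappa> \<gamma> \<in> tops B" if "nontrivial B"
          using tops[OF A B nt that] by simp
        then have "nontrivial B \<Longrightarrow> eval B w (subst (Cst \<circ> \<kappa>) \<gamma>) = \<one>\<^bsub>B\<^esub>"
          by (simp add: tops_def ev)
        moreover have "eval B w (subst (Cst \<circ> \<kappa>) \<gamma>) \<in> carrier B" "\<one>\<^bsub>B\<^esub> \<in> carrier B"
          using eval_closed[OF clB w] clB by (auto simp: ralg_closed_def)
        ultimately show "sat_eq B w (true_eq (subst (Cst \<circ> \<kappa>) \<gamma>))"
          unfolding sat_eq_def true_eq_def nontrivial_def by auto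
      qed
      then show False using pas by (auto simp: passive_premises_def)
    qed
  qed
qed

theorem theorem8p1:
  fixes L :: "fm set \<Rightarrow> fm \<Rightarrow> bool"
  assumes "infinite (UNIV :: 'a set)"
    and "extension_of_RG L"
  shows "(passively_structurally_complete L \<longleftrightarrow>
            (\<exists>K :: 'a ralg set. algebraized_by L K \<and> joint_embedding K)) \<and>
         (passively_structurally_complete L \<longleftrightarrow>
            (\<exists>K :: 'a ralg set. algebraized_by L K \<and> isomorphic_zero_generated K))"
proof -
  define same_tops where "same_tops K \<longleftrightarrow>
    (\<forall>A\<in>K. \<forall>B\<in>K. nontrivial A \<longrightarrow> nontrivial B \<longrightarrow> tops A = tops B)" for K :: "'a ralg set"
  have "passively_structurally_complete L \<longleftrightarrow> same_tops K"
    "joint_embedding K \<longleftrightarrow> same_tops K" "isomorphic_zero_generated K \<longleftrightarrow> same_tops K"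
    if K: "algebraized_by L K" for K :: "'a ralg set"
  proof -
    have qv: "quasivariety K" "K \<subseteq> RGA" using K by (auto simp: algebraized_by_def)
    show "passively_structurally_complete L \<longleftrightarrow> same_tops K"
      unfolding same_tops_def
      using passively_structurally_complete_if_tops_eq[OF K]
        tops_subset_if_passively_structurally_complete[OF K] by (meson subset_antisym)
    show "joint_embedding K \<longleftrightarrow> same_tops K"
      unfolding same_tops_def
      using joint_embedding_if_tops_eq[OF assms(1) qv] tops_eq_if_joint_embedding[OF _ qv(2)] by meson
    show "isomorphic_zero_generated K \<longleftrightarrow> same_tops K"
      unfolding same_tops_def isomorphic_zero_generated_def
      using isomorphic_zero_generated_iff qv(2) by (metis subsetD)
  qed
  \<comment> \<open>From left to right the witness is \<open>models L\<close>; from right to left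
    the equivalences apply to whichever K is given.\<close>
  then show ?thesis using algebraized_by_models[OF assms] by blast
qed

end
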